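(* Let $\Omega=\{a_1,\dots,a_k\}\subseteq\mathbb F$ be a finite set of $k\ge1$ distinct elements, $\vec m=(m_1,\dots,m_k)\in\mathbb Z_{\ge0}^k$ and $N:=\sum_{j=1}^k(m_j+1)$. Put $\mathcal A_N:=\{f\in\mathcal A:\deg f<N\}$. (Left version.) Let $\sigma$ be an endomorphism of $\mathbb F$. The following are equivalent: 1) $\deg(f_\Omega^{\vec m})=N$; 2) the map $\psi:\mathcal A_N\to\mathbb F^N$, $f\mapsto\big((\Delta_{a_1}^0f)(a_1),\dots,(\Delta_{a_1}^{m_1}f)(a_1),\dots,(\Delta_{a_k}^0f)(a_k),\dots,(\Delta_{a_k}^{m_k}f)(a_k)\big)$, is an isomorphism of left $\mathbb F$-modules; 3) for every family $(b_{j,i})_{1\le j\le k,\,0\le i\le m_j}$ of $N$ values in $\mathbb F$ there exists a unique $f\in\mathcal A$ with $\deg(f)<N$ such that $(\Delta_{a_j}^if)(a_j)=b_{j,i}$ for all $1\le j\le k$, $0\le i\le m_j$; 4) $\Omega$ is left DP-independent of type $(m_1,\dots,m_k)$. (Right version.) Let $\sigma$ be an automorphism of $\mathbb F$. The following are equivalent: 1) $\deg(f_{\Omega,L}^{\vec m})=N$; 2) the map $\psi_L:\mathcal A_N\to\mathbb F^N$, $f\mapsto\big((\Delta_{a_1,L}^0f)_L(a_1),\dots,(\Delta_{a_1,L}^{m_1}f)_L(a_1),\dots,(\Delta_{a_k,L}^0f)_L(a_k),\dots,(\Delta_{a_k,L}^{m_k}f)_L(a_k)\big)$, is an isomorphism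 of right $\mathbb F$-modules; 3) for every family $(b_{j,i})_{1\le j\le k,\,0\le i\le m_j}$ of $N$ values in $\mathbb F$ there exists a unique $f\in\mathcal A$ with $\deg(f)<N$ such that $(\Delta_{a_j,L}^if)_L(a_j)=b_{j,i}$ for all $1\le j\le k$, $0\le i\le m_j$; 4) $\Omega$ is right DP-independent of type $(m_1,\dots,m_k)$. In particular, $\Omega$ is left (right) DP-independent of type $\vec m$ if and only if $\deg(f_\Omega^{\vec m})=N$ ($\deg(f_{\Omega,L}^{\vec m})=N$).
   Context: $\mathbb F$ is a division ring, $\sigma$ a (unital) ring endomorphism of $\mathbb F$, $\delta:\mathbb F\to\mathbb F$ a $\sigma$-derivation (additive, $\delta(ab)=\sigma(a)\delta(b)+\delta(a)b$), and $\mathcal A=\mathbb F[x;\sigma,\delta]$ the univariate skew polynomial ring: polynomials $\sum_i c_ix^i$ with coefficients on the left and $xa=\sigma(a)x+\delta(a)$ for $a\in\mathbb F$; $\deg0=-\infty$. For $a\in\mathbb F$, every $f\in\mathcal A$ is uniquely $f=(\Delta_a^1f)(x-a)+f(a)$ with $\Delta_a^1f\in\mathcal A$, $f(a)\in\mathbb F$ (right evaluation $f(a)$). If $\sigma$ is an automorphism, every $f$ is uniquely $f=(x-a)(\Delta_{a,L}^1f)+f_L(a)$ with $\Delta_{a,L}^1f\in\mathcal A$, $f_L(a)\in\mathbb F$ (left evaluation $f_L(a)$). $\Delta_a^t$ and $\Delta_{a,L}^t$ denote $t$-fold iterates of $\Delta_a^1$, $\Delta_{a,L}^1$, and $\Delta_a^0f=\Delta_{a,L}^0f=f$.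 $(\Delta_a^tf)(a)$, $(\Delta_{a,L}^tf)_L(a)$ are their right, respectively left, evaluations at $a$. For $\Omega=\{a_1,\dots,a_k\}$ and $\vec m\in\mathbb Z_{\ge0}^k$: $I^{\vec m}(\Omega)=\{f\in\mathcal A:(\Delta_{a_j}^if)(a_j)=0\ \forall j,\ 0\le i\le m_j\}$, a left ideal, and $I^{\vec m}_L(\Omega)=\{f\in\mathcal A:(\Delta_{a_j,L}^if)_L(a_j)=0\ \forall j,\ 0\le i\le m_j\}$, a right ideal (when $\sigma$ is an automorphism); for $\Omega=\emptyset$ both are $\mathcal A$. These ideals are principal; $f_\Omega^{\vec m}$ and $f_{\Omega,L}^{\vec m}$ denote generators: $I^{\vec m}(\Omega)=\mathcal Af_\Omega^{\vec m}$, $I_L^{\vec m}(\Omega)=f_{\Omega,L}^{\vec m}\mathcal A$. For $t\in\mathbb Z_{\ge0}$, $a\in\mathbb F\setminus\Omega$ is left DP-independent of type $(\vec m,t)$ from $\Omega$ if $I^{\vec m}(\Omega)\supsetneq I^{\vec m,0}(\Omega\cup\{a\})\supsetneq I^{\vec m,1}(\Omega\cup\{a\})\supsetneq\cdots\supsetneq I^{\vec m,t}(\Omega\cup\{a\})$; right DP-independent if the same holds with $I_L$ in place of $I$. $\Omega$ is left (right) DP-independent of type $(m_1,\dots,m_k)$ if for each $j$ the element $a_j$ is left (right) DP-independent of type $((m_1,\dots,m_{j-1},m_{j+1},\dots,m_k),m_j)$ from $\Omega\setminus\{a_j\}$. *)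

theory Defs
  imports "HOL-Computational_Algebra.Polynomial"
begin

section \<open>Skew polynomials over a division ring\<close>

locale skew_derivation =
  fixes \<sigma> \<delta> :: "'a::division_ring \<Rightarrow> 'a"
  assumes sigma_one: "\<sigma> 1 = 1"
    and sigma_add: "\<sigma> (x + y) = \<sigma> x + \<sigma> y"
    and sigma_mult: "\<sigma> (x * y) = \<sigma> x * \<sigma> y"
    and delta_add: "\<delta> (x + y) = \<delta> x + \<delta> y"
    and delta_mult: "\<delta> (x * y) = \<sigma> x * \<delta> y + \<delta> x * y"

text \<open>
  The additive group of \<open>F[x;\<sigma>,\<delta>]\<close> is \<^typ>\<open>'a poly\<close>, with \<open>\<Sum>i. c\<^sub>i x\<^sup>i\<close> given by its left
  coefficients. The library's \<open>*\<close> and \<open>smult\<close> on \<^typ>\<open>'a poly\<close> need commutative coefficients and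
  play no role here. Left multiplication by \<open>x\<close> is forced by \<open>x c = \<sigma>(c) x + \<delta>(c)\<close>:
  it sends \<open>\<Sum>i. c\<^sub>i x\<^sup>i\<close> to \<open>\<Sum>i. \<sigma>(c\<^sub>i) x\<^bsup>i+1\<^esup> + \<delta>(c\<^sub>i) x\<^sup>i\<close>.
\<close>

definition X_mult :: "('a \<Rightarrow> 'a) \<Rightarrow> ('a \<Rightarrow> 'a) \<Rightarrow> 'a::division_ring poly \<Rightarrow> 'a poly" where
  "X_mult \<sigma> \<delta> g = pCons 0 (map_poly \<sigma> g) + map_poly \<delta> g"

definition skew_mult ::
  "('a \<Rightarrow> 'a) \<Rightarrow> ('a \<Rightarrow> 'a) \<Rightarrow> 'a::division_ring poly \<Rightarrow> 'a poly \<Rightarrow> 'a poly" where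
  "skew_mult \<sigma> \<delta> f g = (\<Sum>i\<le>degree f. map_poly ((*) (coeff f i)) ((X_mult \<sigma> \<delta> ^^ i) g))"

text \<open>\<^typ>\<open>'a poly\<close> has \<open>degree 0 = 0\<close>; with \<open>deg 0 = -\<infinity>\<close> the zero polynomial is below every bound.\<close>

definition polys_below :: "nat \<Rightarrow> 'a::zero poly set" where
  "polys_below n = {f. f = 0 \<or> degree f < n}"

section \<open>Evaluations, divided differences and the attached ideals\<close>

text \<open>\<open>[:- a, 1:]\<close> is \<open>x - a\<close> and \<open>[:c:]\<close> the constant \<open>c\<close>.\<close>

definition right_eval ::
  "('a \<Rightarrow> 'a) \<Rightarrow> ('a \<Rightarrow> 'a) \<Rightarrow> 'a::division_ring \<Rightarrow> 'a poly \<Rightarrow> 'a" where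
  "right_eval \<sigma> \<delta> a f = (THE c. \<exists>q. f = skew_mult \<sigma> \<delta> q [:- a, 1:] + [:c:])"

definition right_diff ::
  "('a \<Rightarrow> 'a) \<Rightarrow> ('a \<Rightarrow> 'a) \<Rightarrow> 'a::division_ring \<Rightarrow> 'a poly \<Rightarrow> 'a poly" where
  "right_diff \<sigma> \<delta> a f = (THE q. \<exists>c. f = skew_mult \<sigma> \<delta> q [:- a, 1:] + [:c:])"

definition left_eval ::
  "('a \<Rightarrow> 'a) \<Rightarrow> ('a \<Rightarrow> 'a) \<Rightarrow> 'a::division_ring \<Rightarrow> 'a poly \<Rightarrow> 'a" where
  "left_eval \<sigma> \<delta> a f = (THE c. \<exists>q. f = skew_mult \<sigma> \<delta> [:- a, 1:] q + [:c:])"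

definition left_diff ::
  "('a \<Rightarrow> 'a) \<Rightarrow> ('a \<Rightarrow> 'a) \<Rightarrow> 'a::division_ring \<Rightarrow> 'a poly \<Rightarrow> 'a poly" where
  "left_diff \<sigma> \<delta> a f = (THE q. \<exists>c. f = skew_mult \<sigma> \<delta> [:- a, 1:] q + [:c:])"

text \<open>
  A finite set \<open>\<Omega>\<close> together with its vector \<open>m\<close> is given as the set of pairs \<open>(a\<^sub>j, m\<^sub>j)\<close>, so that
  adding or removing a point with its entry of \<open>m\<close> is adding or removing a pair.
\<close>

definition weighted_points :: "(nat \<Rightarrow> 'a) \<Rightarrow> (nat \<Rightarrow> nat) \<Rightarrow> nat set \<Rightarrow> ('a \<times> nat) set" where
  "weighted_points a m J = (\<lambda>j. (a j, m j)) ` J"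

definition ideal_R ::
  "('a \<Rightarrow> 'a) \<Rightarrow> ('a \<Rightarrow> 'a) \<Rightarrow> ('a::division_ring \<times> nat) set \<Rightarrow> 'a poly set" where
  "ideal_R \<sigma> \<delta> P =
     {f. \<forall>(b, n) \<in> P. \<forall>i\<le>n. right_eval \<sigma> \<delta> b ((right_diff \<sigma> \<delta> b ^^ i) f) = 0}"

definition ideal_L ::
  "('a \<Rightarrow> 'a) \<Rightarrow> ('a \<Rightarrow> 'a) \<Rightarrow> ('a::division_ring \<times> nat) set \<Rightarrow> 'a poly set" where
  "ideal_L \<sigma> \<delta> P =
     {f. \<forall>(b, n) \<in> P. \<forall>i\<le>n. left_eval \<sigma> \<delta> b ((left_diff \<sigma> \<delta> b ^^ i) f) = 0}"

text \<open>
  \<open>ideal_R\<close> is built from right evaluations and is a left ideal; \<open>ideal_L\<close>, from left evaluations,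
  is a right ideal. Accordingly left DP-independence refers to \<open>ideal_R\<close>.
\<close>

definition generates_left_ideal ::
  "('a \<Rightarrow> 'a) \<Rightarrow> ('a \<Rightarrow> 'a) \<Rightarrow> 'a::division_ring poly \<Rightarrow> 'a poly set \<Rightarrow> bool" where
  "generates_left_ideal \<sigma> \<delta> f I \<longleftrightarrow> I = range (\<lambda>g. skew_mult \<sigma> \<delta> g f)"

definition generates_right_ideal ::
  "('a \<Rightarrow> 'a) \<Rightarrow> ('a \<Rightarrow> 'a) \<Rightarrow> 'a::division_ring poly \<Rightarrow> 'a poly set \<Rightarrow> bool" where
  "generates_right_ideal \<sigma> \<delta> f I \<longleftrightarrow> I = range (\<lambda>g. skew_mult \<sigma> \<delta> f g)"

section \<open>DP-independence\<close>

definition left_DP_indep_from ::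
  "('a \<Rightarrow> 'a) \<Rightarrow> ('a \<Rightarrow> 'a) \<Rightarrow> ('a::division_ring \<times> nat) set \<Rightarrow> nat \<Rightarrow> 'a \<Rightarrow> bool" where
  "left_DP_indep_from \<sigma> \<delta> P t b \<longleftrightarrow>
     b \<notin> fst ` P \<and>
     ideal_R \<sigma> \<delta> (insert (b, 0) P) \<subset> ideal_R \<sigma> \<delta> P \<and>
     (\<forall>s<t. ideal_R \<sigma> \<delta> (insert (b, Suc s) P) \<subset> ideal_R \<sigma> \<delta> (insert (b, s) P))"

definition right_DP_indep_from ::
  "('a \<Rightarrow> 'a) \<Rightarrow> ('a \<Rightarrow> 'a) \<Rightarrow> ('a::division_ring \<times> nat) set \<Rightarrow> nat \<Rightarrow> 'a \<Rightarrow> bool" where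
  "right_DP_indep_from \<sigma> \<delta> P t b \<longleftrightarrow>
     b \<notin> fst ` P \<and>
     ideal_L \<sigma> \<delta> (insert (b, 0) P) \<subset> ideal_L \<sigma> \<delta> P \<and>
     (\<forall>s<t. ideal_L \<sigma> \<delta> (insert (b, Suc s) P) \<subset> ideal_L \<sigma> \<delta> (insert (b, s) P))"

definition left_DP_indep ::
  "('a \<Rightarrow> 'a) \<Rightarrow> ('a \<Rightarrow> 'a) \<Rightarrow> nat \<Rightarrow> (nat \<Rightarrow> 'a::division_ring) \<Rightarrow> (nat \<Rightarrow> nat) \<Rightarrow> bool" where
  "left_DP_indep \<sigma> \<delta> k a m \<longleftrightarrow>
     (\<forall>j\<in>{1..k}. left_DP_indep_from \<sigma> \<delta> (weighted_points a m ({1..k} - {j})) (m j) (a j))"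

definition right_DP_indep ::
  "('a \<Rightarrow> 'a) \<Rightarrow> ('a \<Rightarrow> 'a) \<Rightarrow> nat \<Rightarrow> (nat \<Rightarrow> 'a::division_ring) \<Rightarrow> (nat \<Rightarrow> nat) \<Rightarrow> bool" where
  "right_DP_indep \<sigma> \<delta> k a m \<longleftrightarrow>
     (\<forall>j\<in>{1..k}. right_DP_indep_from \<sigma> \<delta> (weighted_points a m ({1..k} - {j})) (m j) (a j))"

section \<open>The evaluation maps and module isomorphisms\<close>

text \<open>The coordinate space \<open>F\<^sup>N\<close> is the set of lists of length \<open>N\<close> with entrywise operations.\<close>

definition coord_space :: "nat \<Rightarrow> 'a list set" where
  "coord_space n = {v. length v = n}"

definition psi_R ::
  "('a \<Rightarrow> 'a) \<Rightarrow> ('a \<Rightarrow> 'a) \<Rightarrow> nat \<Rightarrow> (nat \<Rightarrow> 'a::division_ring) \<Rightarrow> (nat \<Rightarrow> nat)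
    \<Rightarrow> 'a poly \<Rightarrow> 'a list" where
  "psi_R \<sigma> \<delta> k a m f =
     concat (map (\<lambda>j. map (\<lambda>i. right_eval \<sigma> \<delta> (a j) ((right_diff \<sigma> \<delta> (a j) ^^ i) f))
       [0..<m j + 1]) [1..<k + 1])"

definition psi_L ::
  "('a \<Rightarrow> 'a) \<Rightarrow> ('a \<Rightarrow> 'a) \<Rightarrow> nat \<Rightarrow> (nat \<Rightarrow> 'a::division_ring) \<Rightarrow> (nat \<Rightarrow> nat)
    \<Rightarrow> 'a poly \<Rightarrow> 'a list" where
  "psi_L \<sigma> \<delta> k a m f =
     concat (map (\<lambda>j. map (\<lambda>i. left_eval \<sigma> \<delta> (a j) ((left_diff \<sigma> \<delta> (a j) ^^ i) f))
       [0..<m j + 1]) [1..<k + 1])"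

text \<open>
  Isomorphism between modules given by carrier, addition and scalar action. The library's module
  homomorphisms assume commutative scalars; here the action may be from either side.
\<close>

definition module_iso ::
  "'u set \<Rightarrow> ('u \<Rightarrow> 'u \<Rightarrow> 'u) \<Rightarrow> ('r \<Rightarrow> 'u \<Rightarrow> 'u) \<Rightarrow>
   'v set \<Rightarrow> ('v \<Rightarrow> 'v \<Rightarrow> 'v) \<Rightarrow> ('r \<Rightarrow> 'v \<Rightarrow> 'v) \<Rightarrow> ('u \<Rightarrow> 'v) \<Rightarrow> bool" where
  "module_iso U addU actU V addV actV \<phi> \<longleftrightarrow>
     bij_betw \<phi> U V \<and>
     (\<forall>u\<in>U. \<forall>v\<in>U. \<phi> (addU u v) = addV (\<phi> u) (\<phi> v)) \<and>
     (\<forall>c. \<forall>u\<in>U. \<phi> (actU c u) = actV c (\<phi> u))"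

definition left_F_iso ::
  "('a \<Rightarrow> 'a) \<Rightarrow> ('a \<Rightarrow> 'a) \<Rightarrow> nat \<Rightarrow> ('a::division_ring poly \<Rightarrow> 'a list) \<Rightarrow> bool" where
  "left_F_iso \<sigma> \<delta> n \<phi> \<longleftrightarrow>
     module_iso (polys_below n) (+) (\<lambda>c f. skew_mult \<sigma> \<delta> [:c:] f)
       (coord_space n) (map2 (+)) (\<lambda>c v. map (\<lambda>y. c * y) v) \<phi>"

definition right_F_iso ::
  "('a \<Rightarrow> 'a) \<Rightarrow> ('a \<Rightarrow> 'a) \<Rightarrow> nat \<Rightarrow> ('a::division_ring poly \<Rightarrow> 'a list) \<Rightarrow> bool" where
  "right_F_iso \<sigma> \<delta> n \<phi> \<longleftrightarrow>
     module_iso (polys_below n) (+) (\<lambda>c f. skew_mult \<sigma> \<delta> f [:c:])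
       (coord_space n) (map2 (+)) (\<lambda>c v. map (\<lambda>y. y * c) v) \<phi>"

section \<open>The skew product makes \<open>F[x;\<sigma>,\<delta>]\<close> a ring\<close>

context skew_derivation
begin

abbreviation smul (infixl "\<circledast>" 70) where "f \<circledast> g \<equiv> skew_mult \<sigma> \<delta> f g"
abbreviation X where "X \<equiv> X_mult \<sigma> \<delta>"
abbreviation lmul :: "'a \<Rightarrow> 'a poly \<Rightarrow> 'a poly" where "lmul c \<equiv> map_poly ((*) c)"

lemma sigma_zero [simp]: "\<sigma> 0 = 0"
  using sigma_add[of 0 0] by simp

lemma delta_zero [simp]: "\<delta> 0 = 0"
  using delta_add[of 0 0] by simp

lemma delta_one [simp]: "\<delta> 1 = 0"
  using delta_mult[of 1 1] sigma_one by simp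

lemma sigma_eq_0 [simp]: "\<sigma> x = 0 \<longleftrightarrow> x = 0"
proof
  assume "\<sigma> x = 0"
  show "x = 0"
  proof (rule ccontr)
    assume "x \<noteq> 0"
    then have "\<sigma> x * \<sigma> (inverse x) = 1"
      by (simp flip: sigma_mult add: sigma_one)
    with \<open>\<sigma> x = 0\<close> show False by simp
  qed
qed simp

lemma sigma_pow_eq_0 [simp]: "(\<sigma> ^^ n) x = 0 \<longleftrightarrow> x = 0"
  by (induction n) auto

lemma coeff_lmul [simp]: "coeff (lmul c g) i = c * coeff g i"
  by (simp add: coeff_map_poly)

lemma coeff_X: "coeff (X g) i = (if i = 0 then 0 else \<sigma> (coeff g (i - 1))) + \<delta> (coeff g i)"
  by (cases i) (simp_all add: X_mult_def coeff_map_poly)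

lemma X_add: "X (f + g) = X f + X g"
  by (rule poly_eqI) (simp add: coeff_X sigma_add delta_add)

lemma X_lmul: "X (lmul c g) = lmul (\<sigma> c) (X g) + lmul (\<delta> c) g"
  by (rule poly_eqI) (simp add: coeff_X sigma_mult delta_mult algebra_simps)

lemma X_pow_add: "(X ^^ n) (f + g) = (X ^^ n) f + (X ^^ n) g"
  by (induction n) (simp_all add: X_add)

lemma X_zero [simp]: "X 0 = 0"
  by (rule poly_eqI) (simp add: coeff_X)

lemma X_pow_zero [simp]: "(X ^^ n) 0 = 0"
  by (induction n) simp_all

lemma X_sum: "X (sum h A) = (\<Sum>i\<in>A. X (h i))"
  by (induction A rule: infinite_finite_induct) (simp_all add: X_add)

lemma lmul_add: "lmul c (f + g) = lmul c f + lmul c g"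
  by (rule poly_eqI) (simp add: algebra_simps)

lemma lmul_add_left: "lmul (c + d) f = lmul c f + lmul d f"
  by (rule poly_eqI) (simp add: algebra_simps)

lemma lmul_zero_left [simp]: "lmul 0 f = 0"
  by (rule poly_eqI) simp

lemma lmul_one [simp]: "lmul 1 f = f"
  by (rule poly_eqI) simp

lemma lmul_lmul: "lmul c (lmul d f) = lmul (c * d) f"
  by (rule poly_eqI) (simp add: mult.assoc)

lemma lmul_sum: "lmul c (sum h A) = (\<Sum>i\<in>A. lmul c (h i))"
  by (induction A rule: infinite_finite_induct) (simp_all add: lmul_add)

lemma skew_mult_upto:
  assumes "degree f \<le> n"
  shows "f \<circledast> g = (\<Sum>i\<le>n. lmul (coeff f i) ((X ^^ i) g))"
  unfolding skew_mult_def
  by (rule sum.mono_neutral_left) (use assms in \<open>auto simp: coeff_eq_0\<close>)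

lemma skew_mult_add_right: "f \<circledast> (g + h) = f \<circledast> g + f \<circledast> h"
  by (simp add: skew_mult_def X_pow_add lmul_add sum.distrib)

lemma skew_mult_add_left: "(f + g) \<circledast> h = f \<circledast> h + g \<circledast> h"
proof -
  let ?n = "max (degree f) (degree g)"
  have "degree (f + g) \<le> ?n" by (rule degree_add_le_max)
  then show ?thesis
    by (simp add: skew_mult_upto[of _ ?n] lmul_add_left sum.distrib)
qed

lemma skew_mult_zero_left [simp]: "0 \<circledast> g = 0"
  by (simp add: skew_mult_def)

lemma skew_mult_zero_right [simp]: "f \<circledast> 0 = 0"
  by (simp add: skew_mult_def)

lemma skew_mult_minus_left: "(- f) \<circledast> g = - (f \<circledast> g)"
  using skew_mult_add_left[of f "- f" g] by (simp add: minus_unique)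

lemma skew_mult_minus_right: "f \<circledast> (- g) = - (f \<circledast> g)"
  using skew_mult_add_right[of f g "- g"] by (simp add: minus_unique)

lemma skew_mult_diff_left: "(f - g) \<circledast> h = f \<circledast> h - g \<circledast> h"
  using skew_mult_add_left[of f "- g" h] by (simp add: skew_mult_minus_left)

lemma skew_mult_diff_right: "f \<circledast> (g - h) = f \<circledast> g - f \<circledast> h"
  using skew_mult_add_right[of f g "- h"] by (simp add: skew_mult_minus_right)

lemma const_skew_mult: "[:c:] \<circledast> g = lmul c g"
  by (simp add: skew_mult_def)

lemma skew_mult_one_left: "[:1:] \<circledast> g = g"
  by (simp add: const_skew_mult)

lemma X_skew_mult: "[:0, 1:] \<circledast> g = X g"
  by (simp add: skew_mult_def)

lemma commutation_rule: "[:0, 1:] \<circledast> [:c:] = [:\<delta> c, \<sigma> c:]"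
  unfolding X_skew_mult by (rule poly_eqI) (auto simp: coeff_X coeff_pCons split: nat.splits)

lemma X_pow_one: "(X ^^ n) [:1:] = monom 1 n"
  by (induction n) (auto intro!: poly_eqI simp: coeff_X sigma_one simp flip: monom_0)

lemma skew_mult_one_right: "f \<circledast> [:1:] = f"
proof -
  have "f \<circledast> [:1:] = (\<Sum>i\<le>degree f. monom (coeff f i) i)"
    by (simp add: skew_mult_def X_pow_one map_poly_monom)
  then show ?thesis by (simp add: poly_as_sum_of_monoms)
qed

lemma skew_mult_sum_left: "(sum h A) \<circledast> g = (\<Sum>i\<in>A. h i \<circledast> g)"
  by (induction A rule: infinite_finite_induct) (simp_all add: skew_mult_add_left)

lemma degree_X_le: "degree (X f) \<le> Suc (degree f)"
  by (rule degree_le) (simp add: coeff_X coeff_eq_0)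

lemma lmul_skew_mult: "lmul c f \<circledast> g = lmul c (f \<circledast> g)"
proof -
  have "degree (lmul c f) \<le> degree f" by (rule degree_le) (simp add: coeff_eq_0)
  then show ?thesis
    by (simp add: skew_mult_upto[of _ "degree f"] lmul_sum lmul_lmul)
qed

lemma X_assoc: "X f \<circledast> g = X (f \<circledast> g)"
proof -
  let ?n = "degree f"
  have "X f \<circledast> g = (\<Sum>i\<le>Suc ?n. lmul (coeff (X f) i) ((X ^^ i) g))"
    by (rule skew_mult_upto) (rule degree_X_le)
  also have "\<dots> = (\<Sum>i\<le>Suc ?n. lmul (if i = 0 then 0 else \<sigma> (coeff f (i - 1))) ((X ^^ i) g))
       + (\<Sum>i\<le>Suc ?n. lmul (\<delta> (coeff f i)) ((X ^^ i) g))"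
    by (simp only: coeff_X lmul_add_left sum.distrib)
  also have "(\<Sum>i\<le>Suc ?n. lmul (if i = 0 then 0 else \<sigma> (coeff f (i - 1))) ((X ^^ i) g)) =
      (\<Sum>i\<le>?n. lmul (\<sigma> (coeff f i)) ((X ^^ Suc i) g))"
    by (subst sum.atMost_Suc_shift) (simp del: funpow.simps)
  also have "(\<Sum>i\<le>Suc ?n. lmul (\<delta> (coeff f i)) ((X ^^ i) g)) =
      (\<Sum>i\<le>?n. lmul (\<delta> (coeff f i)) ((X ^^ i) g))"
    by (simp add: coeff_eq_0)
  finally show ?thesis
    by (simp add: skew_mult_def[of _ _ f g] X_sum X_lmul sum.distrib)
qed

lemma X_pow_assoc: "(X ^^ n) f \<circledast> g = (X ^^ n) (f \<circledast> g)"
  by (induction n) (simp_all add: X_assoc)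

lemma skew_mult_assoc: "(f \<circledast> g) \<circledast> h = f \<circledast> (g \<circledast> h)"
  by (simp add: skew_mult_def[of _ _ f] skew_mult_sum_left lmul_skew_mult X_pow_assoc)

lemma X_pow_lead:
  shows "degree ((X ^^ n) g) \<le> n + degree g"
    and "coeff ((X ^^ n) g) (n + degree g) = (\<sigma> ^^ n) (lead_coeff g)"
proof (induction n)
  case 0
  { case 1 then show ?case by simp }
  { case 2 then show ?case by simp }
next
  case (Suc n)
  { case 1 then show ?case using degree_X_le[of "(X ^^ n) g"] Suc(1) by simp }
  { case 2 then show ?case using Suc by (simp add: coeff_X coeff_eq_0) }
qed

lemma degree_skew_mult_le: "degree (f \<circledast> g) \<le> degree f + degree g"
proof (rule degree_le, intro allI impI)
  fix i assume i: "degree f + degree g < i"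
  have "coeff ((X ^^ j) g) i = 0" if "j \<le> degree f" for j
    using X_pow_lead(1)[of j g] i that by (intro coeff_eq_0) simp
  then show "coeff (f \<circledast> g) i = 0" by (simp add: skew_mult_def coeff_sum)
qed

lemma lead_skew_mult:
  "coeff (f \<circledast> g) (degree f + degree g) = lead_coeff f * (\<sigma> ^^ degree f) (lead_coeff g)"
proof -
  have "coeff ((X ^^ j) g) (degree f + degree g) = 0" if "j < degree f" for j
    using X_pow_lead(1)[of j g] that by (intro coeff_eq_0) simp
  then have "(\<Sum>j\<in>{..<degree f}. coeff f j * coeff ((X ^^ j) g) (degree f + degree g)) = 0"
    by simp
  then show ?thesis
    by (simp add: skew_mult_def coeff_sum X_pow_lead(2) flip: lessThan_Suc_atMost)
qed

lemma skew_mult_nonzero: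
  assumes "f \<noteq> 0" "g \<noteq> 0"
  shows "f \<circledast> g \<noteq> 0" "degree (f \<circledast> g) = degree f + degree g"
proof -
  have "coeff (f \<circledast> g) (degree f + degree g) \<noteq> 0"
    using assms by (simp add: lead_skew_mult)
  then show "f \<circledast> g \<noteq> 0" "degree (f \<circledast> g) = degree f + degree g"
    using degree_skew_mult_le[of f g] by (auto intro: antisym le_degree)
qed

section \<open>Division with remainder and well-definedness\<close>

lemma division_step:
  fixes f h :: "'a poly"
  assumes "degree h = degree f" "lead_coeff h = lead_coeff f"
  shows "f - h = 0 \<or> degree (f - h) < degree f"
proof (cases "f - h = 0")
  case False
  have "degree (f - h) \<le> degree f" using assms by (intro degree_diff_le) simp_all
  moreover have "degree (f - h) \<noteq> degree f"
  proof
    assume "degree (f - h) = degree f"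
    then have "lead_coeff (f - h) = 0" using assms by (metis coeff_diff diff_self)
    with False show False by (metis leading_coeff_0_iff)
  qed
  ultimately show ?thesis by simp
qed simp

lemma right_division:
  assumes "g \<noteq> 0"
  shows "\<exists>q r. f = q \<circledast> g + r \<and> r \<in> polys_below (degree g)"
proof (induction "degree f" arbitrary: f rule: less_induct)
  case less
  show ?case
  proof (cases "f \<in> polys_below (degree g)")
    case True
    then show ?thesis by (intro exI[of _ 0] exI[of _ f]) simp
  next
    case False
    define d where "d = degree f - degree g"
    define c where "c = lead_coeff f * inverse ((\<sigma> ^^ d) (lead_coeff g))"
    have f: "f \<noteq> 0" "degree f = d + degree g"
      using False by (auto simp: polys_below_def d_def)
    have "c \<noteq> 0" using assms f(1) by (simp add: c_def)
    then have t: "monom c d \<noteq> 0" "degree (monom c d) = d" "lead_coeff (monom c d) = c"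
      by (simp_all add: degree_monom_eq)
    have deg: "degree (monom c d \<circledast> g) = degree f"
      using skew_mult_nonzero(2)[OF t(1) assms] t(2) f by simp
    have "lead_coeff (monom c d \<circledast> g) = c * (\<sigma> ^^ d) (lead_coeff g)"
      using lead_skew_mult[of "monom c d" g] t deg f by simp
    also have "\<dots> = lead_coeff f"
      using assms by (simp add: c_def mult.assoc)
    finally have "f - monom c d \<circledast> g = 0 \<or> degree (f - monom c d \<circledast> g) < degree f"
      by (intro division_step deg)
    then obtain q r where "f - monom c d \<circledast> g = q \<circledast> g + r" "r \<in> polys_below (degree g)"
    proof
      assume "f - monom c d \<circledast> g = 0"
      then show thesis by (intro that[of 0 0]) (simp_all add: polys_below_def)
    qed (use less that in blast)
    then have "f = (monom c d + q) \<circledast> g + r"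
      by (simp add: skew_mult_add_left algebra_simps)
    with \<open>r \<in> _\<close> show ?thesis by blast
  qed
qed

lemma left_division:
  assumes "bij \<sigma>" "g \<noteq> 0"
  shows "\<exists>q r. f = g \<circledast> q + r \<and> r \<in> polys_below (degree g)"
proof (induction "degree f" arbitrary: f rule: less_induct)
  case less
  show ?case
  proof (cases "f \<in> polys_below (degree g)")
    case True
    then show ?thesis by (intro exI[of _ 0] exI[of _ f]) simp
  next
    case False
    define d where "d = degree f - degree g"
    have f: "f \<noteq> 0" "degree f = degree g + d"
      using False by (auto simp: polys_below_def d_def)
    have "surj (\<sigma> ^^ degree g)"
      using assms(1) by (simp add: bij_is_surj surj_fn)
    then obtain c where c: "inverse (lead_coeff g) * lead_coeff f = (\<sigma> ^^ degree g) c"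
      by (metis surjD)
    have "(\<sigma> ^^ degree g) c \<noteq> 0" using assms f(1) by (simp flip: c)
    then have t: "monom c d \<noteq> 0" "degree (monom c d) = d" "lead_coeff (monom c d) = c"
      by (simp_all add: degree_monom_eq)
    have deg: "degree (g \<circledast> monom c d) = degree f"
      using skew_mult_nonzero(2)[OF assms(2) t(1)] t(2) f by simp
    have "lead_coeff (g \<circledast> monom c d) = lead_coeff g * (\<sigma> ^^ degree g) c"
      using lead_skew_mult[of g "monom c d"] t deg f by simp
    also have "\<dots> = lead_coeff f"
      using assms by (simp flip: c mult.assoc)
    finally have "f - g \<circledast> monom c d = 0 \<or> degree (f - g \<circledast> monom c d) < degree f"
      by (intro division_step deg)
    then obtain q r where "f - g \<circledast> monom c d = g \<circledast> q + r" "r \<in> polys_below (degree g)"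
    proof
      assume "f - g \<circledast> monom c d = 0"
      then show thesis by (intro that[of 0 0]) (simp_all add: polys_below_def)
    qed (use less that in blast)
    then have "f = g \<circledast> (monom c d + q) + r"
      by (simp add: skew_mult_add_right algebra_simps)
    with \<open>r \<in> _\<close> show ?thesis by blast
  qed
qed

lemma cross_diff: "u + c = v + d \<Longrightarrow> u - v = d - c" for u v c d :: "'a poly"
proof -
  assume eq: "u + c = v + d"
  have "u - v = (u + c) - c - v" by simp
  also have "\<dots> = d - c" unfolding eq by (simp add: algebra_simps)
  finally show ?thesis .
qed

lemma right_linear_unique:
  assumes "q \<circledast> [:- a, 1:] + [:c:] = q' \<circledast> [:- a, 1:] + [:c':]"
  shows "q = q'" "c = c'"
proof -
  have "q \<circledast> [:- a, 1:] - q' \<circledast> [:- a, 1:] = [:c':] - [:c:]"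
    using assms by (rule cross_diff)
  then have eq: "(q - q') \<circledast> [:- a, 1:] = [:c' - c:]"
    by (simp add: skew_mult_diff_left)
  show "q = q'"
  proof (rule ccontr)
    assume "q \<noteq> q'"
    then have "degree ((q - q') \<circledast> [:- a, 1:]) = degree (q - q') + 1"
      by (subst skew_mult_nonzero) simp_all
    then show False by (simp add: eq)
  qed
  with assms show "c = c'" by simp
qed

lemma left_linear_unique:
  assumes "[:- a, 1:] \<circledast> q + [:c:] = [:- a, 1:] \<circledast> q' + [:c':]"
  shows "q = q'" "c = c'"
proof -
  have "[:- a, 1:] \<circledast> q - [:- a, 1:] \<circledast> q' = [:c':] - [:c:]"
    using assms by (rule cross_diff)
  then have eq: "[:- a, 1:] \<circledast> (q - q') = [:c' - c:]"
    by (simp add: skew_mult_diff_right)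
  show "q = q'"
  proof (rule ccontr)
    assume "q \<noteq> q'"
    then have "degree ([:- a, 1:] \<circledast> (q - q')) = 1 + degree (q - q')"
      by (subst skew_mult_nonzero) simp_all
    then show False by (simp add: eq)
  qed
  with assms show "c = c'" by simp
qed

lemma polys_below_1: "r \<in> polys_below (Suc 0) \<longleftrightarrow> (\<exists>c. r = [:c:])"
  by (auto simp: polys_below_def elim: degree_eq_zeroE)

lemma right_eqI:
  assumes "f = q \<circledast> [:- a, 1:] + [:c:]"
  shows "right_diff \<sigma> \<delta> a f = q" "right_eval \<sigma> \<delta> a f = c"
  unfolding right_diff_def right_eval_def
  by (rule the_equality; use assms right_linear_unique in blast)+

lemma left_eqI:
  assumes "f = [:- a, 1:] \<circledast> q + [:c:]"
  shows "left_diff \<sigma> \<delta> a f = q" "left_eval \<sigma> \<delta> a f = c"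
  unfolding left_diff_def left_eval_def
  by (rule the_equality; use assms left_linear_unique in blast)+

lemma right_decomp: "f = right_diff \<sigma> \<delta> a f \<circledast> [:- a, 1:] + [:right_eval \<sigma> \<delta> a f:]"
proof -
  obtain q c where "f = q \<circledast> [:- a, 1:] + [:c:]"
    using right_division[of "[:- a, 1:]" f] by (auto simp: polys_below_1)
  then show ?thesis using right_eqI by metis
qed

lemma left_decomp:
  assumes "bij \<sigma>"
  shows "f = [:- a, 1:] \<circledast> left_diff \<sigma> \<delta> a f + [:left_eval \<sigma> \<delta> a f:]"
proof -
  obtain q c where "f = [:- a, 1:] \<circledast> q + [:c:]"
    using left_division[OF assms, of "[:- a, 1:]" f] by (auto simp: polys_below_1)
  then show ?thesis using left_eqI by metis
qed

lemma right_diff_add: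
  "right_diff \<sigma> \<delta> a (f + g) = right_diff \<sigma> \<delta> a f + right_diff \<sigma> \<delta> a g"
  "right_eval \<sigma> \<delta> a (f + g) = right_eval \<sigma> \<delta> a f + right_eval \<sigma> \<delta> a g"
proof -
  have "f + g = (right_diff \<sigma> \<delta> a f + right_diff \<sigma> \<delta> a g) \<circledast> [:- a, 1:]
      + [:right_eval \<sigma> \<delta> a f + right_eval \<sigma> \<delta> a g:]"
    by (subst right_decomp[of f a], subst right_decomp[of g a])
      (simp add: skew_mult_add_left algebra_simps)
  from right_eqI[OF this] show
    "right_diff \<sigma> \<delta> a (f + g) = right_diff \<sigma> \<delta> a f + right_diff \<sigma> \<delta> a g"
    "right_eval \<sigma> \<delta> a (f + g) = right_eval \<sigma> \<delta> a f + right_eval \<sigma> \<delta> a g" .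
qed

lemma left_diff_add:
  assumes "bij \<sigma>"
  shows "left_diff \<sigma> \<delta> a (f + g) = left_diff \<sigma> \<delta> a f + left_diff \<sigma> \<delta> a g"
    "left_eval \<sigma> \<delta> a (f + g) = left_eval \<sigma> \<delta> a f + left_eval \<sigma> \<delta> a g"
proof -
  have "f + g = [:- a, 1:] \<circledast> (left_diff \<sigma> \<delta> a f + left_diff \<sigma> \<delta> a g)
      + [:left_eval \<sigma> \<delta> a f + left_eval \<sigma> \<delta> a g:]"
    by (subst left_decomp[OF assms, of f a], subst left_decomp[OF assms, of g a])
      (simp add: skew_mult_add_right algebra_simps)
  from left_eqI[OF this] show
    "left_diff \<sigma> \<delta> a (f + g) = left_diff \<sigma> \<delta> a f + left_diff \<sigma> \<delta> a g"
    "left_eval \<sigma> \<delta> a (f + g) = left_eval \<sigma> \<delta> a f + left_eval \<sigma> \<delta> a g" .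
qed

lemma right_diff_mult:
  assumes "right_eval \<sigma> \<delta> a f = 0"
  shows "right_diff \<sigma> \<delta> a (g \<circledast> f) = g \<circledast> right_diff \<sigma> \<delta> a f" "right_eval \<sigma> \<delta> a (g \<circledast> f) = 0"
proof -
  have "g \<circledast> f = (g \<circledast> right_diff \<sigma> \<delta> a f) \<circledast> [:- a, 1:] + [:0:]"
    using right_decomp[of f a] assms by (simp add: skew_mult_assoc)
  from right_eqI[OF this] show
    "right_diff \<sigma> \<delta> a (g \<circledast> f) = g \<circledast> right_diff \<sigma> \<delta> a f" "right_eval \<sigma> \<delta> a (g \<circledast> f) = 0" .
qed

lemma left_diff_mult:
  assumes "bij \<sigma>" "left_eval \<sigma> \<delta> a f = 0"
  shows "left_diff \<sigma> \<delta> a (f \<circledast> g) = left_diff \<sigma> \<delta> a f \<circledast> g" "left_eval \<sigma> \<delta> a (f \<circledast> g) = 0"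
proof -
  have "f \<circledast> g = [:- a, 1:] \<circledast> (left_diff \<sigma> \<delta> a f \<circledast> g) + [:0:]"
    using left_decomp[OF assms(1), of f a] assms(2) by (simp flip: skew_mult_assoc)
  from left_eqI[OF this] show
    "left_diff \<sigma> \<delta> a (f \<circledast> g) = left_diff \<sigma> \<delta> a f \<circledast> g" "left_eval \<sigma> \<delta> a (f \<circledast> g) = 0" .
qed

lemma all_le_Suc_shift: "(\<forall>i\<le>Suc n. P i) \<longleftrightarrow> P 0 \<and> (\<forall>i\<le>n. P (Suc i))"
  by (metis Suc_le_mono le0 not0_implies_Suc)

lemma right_pow_add:
  "(right_diff \<sigma> \<delta> a ^^ i) (f + g) = (right_diff \<sigma> \<delta> a ^^ i) f + (right_diff \<sigma> \<delta> a ^^ i) g"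
  by (induction i) (simp_all add: right_diff_add)

lemma left_pow_add:
  assumes "bij \<sigma>"
  shows "(left_diff \<sigma> \<delta> a ^^ i) (f + g) = (left_diff \<sigma> \<delta> a ^^ i) f + (left_diff \<sigma> \<delta> a ^^ i) g"
  by (induction i) (simp_all add: left_diff_add assms)

lemma right_vanish_mult:
  assumes "\<forall>i\<le>n. right_eval \<sigma> \<delta> a ((right_diff \<sigma> \<delta> a ^^ i) f) = 0"
  shows "\<forall>i\<le>n. right_eval \<sigma> \<delta> a ((right_diff \<sigma> \<delta> a ^^ i) (g \<circledast> f)) = 0"
  using assms
proof (induction n arbitrary: f)
  case 0
  then show ?case by (simp add: right_diff_mult)
next
  case (Suc n)
  then show ?case
    by (simp add: all_le_Suc_shift funpow_Suc_right right_diff_mult del: funpow.simps(2))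
qed

lemma left_vanish_mult:
  assumes "bij \<sigma>" "\<forall>i\<le>n. left_eval \<sigma> \<delta> a ((left_diff \<sigma> \<delta> a ^^ i) f) = 0"
  shows "\<forall>i\<le>n. left_eval \<sigma> \<delta> a ((left_diff \<sigma> \<delta> a ^^ i) (f \<circledast> g)) = 0"
  using assms(2)
proof (induction n arbitrary: f)
  case 0
  then show ?case by (simp add: left_diff_mult assms)
next
  case (Suc n)
  then show ?case
    by (simp add: all_le_Suc_shift funpow_Suc_right left_diff_mult assms del: funpow.simps(2))
qed

lemma ideal_R_add: "f \<in> ideal_R \<sigma> \<delta> P \<Longrightarrow> g \<in> ideal_R \<sigma> \<delta> P \<Longrightarrow> f + g \<in> ideal_R \<sigma> \<delta> P"
  by (fastforce simp: ideal_R_def right_pow_add right_diff_add)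

lemma ideal_L_add:
  "bij \<sigma> \<Longrightarrow> f \<in> ideal_L \<sigma> \<delta> P \<Longrightarrow> g \<in> ideal_L \<sigma> \<delta> P \<Longrightarrow> f + g \<in> ideal_L \<sigma> \<delta> P"
  by (fastforce simp: ideal_L_def left_pow_add left_diff_add)

lemma ideal_R_mult: "f \<in> ideal_R \<sigma> \<delta> P \<Longrightarrow> g \<circledast> f \<in> ideal_R \<sigma> \<delta> P"
  using right_vanish_mult by (fastforce simp: ideal_R_def)

lemma ideal_L_mult: "bij \<sigma> \<Longrightarrow> f \<in> ideal_L \<sigma> \<delta> P \<Longrightarrow> f \<circledast> g \<in> ideal_L \<sigma> \<delta> P"
  using left_vanish_mult by (fastforce simp: ideal_L_def)

lemma ideal_zero: "0 \<in> ideal_R \<sigma> \<delta> P" "0 \<in> ideal_L \<sigma> \<delta> P"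
proof -
  have "right_diff \<sigma> \<delta> a 0 = 0 \<and> right_eval \<sigma> \<delta> a 0 = 0" for a
    using right_eqI[of 0 0 a 0] by simp
  moreover from this have "(right_diff \<sigma> \<delta> a ^^ i) 0 = 0" for i a by (induction i) simp_all
  ultimately show "0 \<in> ideal_R \<sigma> \<delta> P" by (simp add: ideal_R_def)
  have "left_diff \<sigma> \<delta> a 0 = 0 \<and> left_eval \<sigma> \<delta> a 0 = 0" for a
    using left_eqI[of 0 a 0 0] by simp
  moreover from this have "(left_diff \<sigma> \<delta> a ^^ i) 0 = 0" for i a by (induction i) simp_all
  ultimately show "0 \<in> ideal_L \<sigma> \<delta> P" by (simp add: ideal_L_def)
qed

lemma min_degree_element:
  fixes I :: "'a poly set"
  assumes "f \<in> I" "f \<noteq> 0"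
  obtains g where "g \<in> I" "g \<noteq> 0" "I \<inter> polys_below (degree g) \<subseteq> {0}"
proof -
  obtain g where "g \<in> I \<and> g \<noteq> 0" "\<forall>h. h \<in> I \<and> h \<noteq> 0 \<longrightarrow> degree g \<le> degree h"
    using ex_has_least_nat[of "\<lambda>h. h \<in> I \<and> h \<noteq> 0" f degree] assms by blast
  then show thesis by (intro that[of g]) (auto simp: polys_below_def)
qed

text \<open>The generators quantified over in the main statement exist.\<close>

lemma left_generator_exists: "\<exists>f. generates_left_ideal \<sigma> \<delta> f (ideal_R \<sigma> \<delta> P)"
proof (cases "ideal_R \<sigma> \<delta> P = {0}")
  case True
  then show ?thesis by (intro exI[of _ 0]) (simp add: generates_left_ideal_def)
next
  case False
  then obtain f where "f \<in> ideal_R \<sigma> \<delta> P" "f \<noteq> 0" using ideal_zero by blast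
  from min_degree_element[OF this] obtain g where g: "g \<in> ideal_R \<sigma> \<delta> P" "g \<noteq> 0"
    "ideal_R \<sigma> \<delta> P \<inter> polys_below (degree g) \<subseteq> {0}" .
  have "h \<in> range (\<lambda>q. q \<circledast> g)" if h: "h \<in> ideal_R \<sigma> \<delta> P" for h
  proof -
    obtain q r where qr: "h = q \<circledast> g + r" "r \<in> polys_below (degree g)"
      using right_division[OF g(2)] by blast
    then have "r = h + (- q) \<circledast> g" by (simp add: skew_mult_minus_left)
    then have "r \<in> ideal_R \<sigma> \<delta> P" using h g ideal_R_add ideal_R_mult by metis
    with g qr have "r = 0" by blast
    with qr show ?thesis by simp
  qed
  then show ?thesis
    unfolding generates_left_ideal_def using ideal_R_mult g(1) by blast
qed

lemma right_generator_exists: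
  assumes "bij \<sigma>"
  shows "\<exists>f. generates_right_ideal \<sigma> \<delta> f (ideal_L \<sigma> \<delta> P)"
proof (cases "ideal_L \<sigma> \<delta> P = {0}")
  case True
  then show ?thesis by (intro exI[of _ 0]) (simp add: generates_right_ideal_def)
next
  case False
  then obtain f where "f \<in> ideal_L \<sigma> \<delta> P" "f \<noteq> 0" using ideal_zero by blast
  from min_degree_element[OF this] obtain g where g: "g \<in> ideal_L \<sigma> \<delta> P" "g \<noteq> 0"
    "ideal_L \<sigma> \<delta> P \<inter> polys_below (degree g) \<subseteq> {0}" .
  have "h \<in> range (\<lambda>q. g \<circledast> q)" if h: "h \<in> ideal_L \<sigma> \<delta> P" for h
  proof -
    obtain q r where qr: "h = g \<circledast> q + r" "r \<in> polys_below (degree g)"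
      using left_division[OF assms g(2)] by blast
    then have "r = h + g \<circledast> (- q)" by (simp add: skew_mult_minus_right)
    then have "r \<in> ideal_L \<sigma> \<delta> P" using h g ideal_L_add ideal_L_mult assms by metis
    with g qr have "r = 0" by blast
    with qr show ?thesis by simp
  qed
  then show ?thesis
    unfolding generates_right_ideal_def using ideal_L_mult[OF assms] g(1) by blast
qed

end

end

theory Submission
  imports Defs
begin

text \<open>
  The \<open>N\<close> evaluations \<open>f \<mapsto> (\<Delta>\<^sub>a\<^sup>i f)(a)\<close> are \<open>F\<close>-linear functionals on the skew polynomials, and
  the ideal attached to \<open>\<Omega>\<close> is their common kernel. The theorem says that the functionals are linearly
  independent, in several guises. Apart from this linearity,
  skew multiplication enters through two facts: the kernel is a one-sided ideal, and the degree of a nonzero product is the sum of the degrees.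

  The codimension of a kernel is measured by its \<^emph>\<open>gaps\<close>, the degrees that no nonzero element of it
  has; this replaces a dimension theory over noncommutative scalars. Imposing one more linear
  condition on a kernel either changes nothing or creates exactly one new gap
  (\<open>gaps_Ker_insert\<close>). Hence \<open>N\<close> functionals leave at most \<open>N\<close> gaps, with equality iff none of them
  vanishes on the common kernel of the others (\<open>card_gaps_eq_iff_independent\<close>). The ideal
  generated by a nonzero \<open>f\<close> has as gaps the numbers below \<open>deg f\<close>, so \<open>deg f = N\<close> is exactly this
  independence.

  Independence yields a dual family, so that any values can be interpolated by some polynomial; as the gaps
  of the ideal are then the numbers below \<open>N\<close>, subtracting kernel elements brings the degree below \<open>N\<close>,
  and two such solutions cannot differ. Interpolation of the unit vectors gives independence
  back, and unique interpolation of all value vectors is bijectivity of the linear map \<open>\<psi>\<close>.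

  DP-independence looks weaker at first sight: it makes the functional of order \<open>s\<close> at \<open>a\<^sub>j\<close> nonzero on the
  common kernel of those at the other points and those of order \<open>< s\<close> at \<open>a\<^sub>j\<close> itself. The remaining orders
  \<open>> s\<close> at \<open>a\<^sub>j\<close> are removed one at a time by Gaussian elimination, because the chain at \<open>a\<^sub>j\<close> also provides
  pivots for them (\<open>independent_Sigma_iff\<close>).

  The left and the right version differ only in the side from which scalars act. Both are
  instances of the locale \<open>evaluation_family\<close>, in which the linear algebra is carried out.
\<close>

section \<open>Counting the degrees missing from a common kernel\<close>

definition gaps :: "'a::zero poly set \<Rightarrow> nat set" where
  "gaps V = {n. \<forall>f\<in>V. f \<noteq> 0 \<longrightarrow> degree f \<noteq> n}"

lemma gaps_antimono: "V \<subseteq> W \<Longrightarrow> gaps W \<subseteq> gaps V"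
  by (auto simp: gaps_def)

lemma not_gapE:
  assumes "n \<notin> gaps V"
  obtains f where "f \<in> V" "f \<noteq> 0" "degree f = n"
  using assms by (auto simp: gaps_def)

lemma not_gapI: "f \<in> V \<Longrightarrow> f \<noteq> 0 \<Longrightarrow> degree f = n \<Longrightarrow> n \<notin> gaps V"
  by (auto simp: gaps_def)

lemma in_polys_belowD: "f \<in> polys_below n \<Longrightarrow> f \<noteq> 0 \<Longrightarrow> degree f < n"
  by (auto simp: polys_below_def)

lemma down_closed_eq_lessThan_card:
  fixes G :: "nat set"
  assumes "finite G" and down: "\<And>n. Suc n \<in> G \<Longrightarrow> n \<in> G"
  shows "G = {..<card G}"
proof -
  have below: "l \<in> G" if "l \<le> n" "n \<in> G" for l n
    using that by (induction rule: inc_induct) (auto intro: down)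
  have "\<exists>n. n \<notin> G" using assms(1) ex_new_if_finite infinite_UNIV_nat by blast
  define d where "d = (LEAST n. n \<notin> G)"
  have "d \<notin> G" unfolding d_def using \<open>\<exists>n. n \<notin> G\<close> by (rule LeastI_ex)
  moreover have "n \<in> G" if "n < d" for n using not_less_Least[OF that[unfolded d_def]] by simp
  ultimately have "G = {..<d}" using below[of d] by (intro set_eqI) (metis lessThan_iff not_less)
  then show ?thesis by simp
qed

lemma bij_betw_iff_ex1:
  assumes into: "\<And>x. x \<in> A \<Longrightarrow> f x \<in> B"
  shows "bij_betw f A B \<longleftrightarrow> (\<forall>y\<in>B. \<exists>!x. x \<in> A \<and> f x = y)"
proof
  assume "bij_betw f A B"
  then show "\<forall>y\<in>B. \<exists>!x. x \<in> A \<and> f x = y"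
    by (auto simp: bij_betw_def inj_on_def)
next
  assume *: "\<forall>y\<in>B. \<exists>!x. x \<in> A \<and> f x = y"
  have "inj_on f A" using * into by (intro inj_onI) metis
  moreover have "f ` A = B" using * into by blast
  ultimately show "bij_betw f A B" by (simp add: bij_betw_def)
qed

text \<open>
  \<open>act\<close> is the scalar action on polynomials and \<open>mul\<close> the one on values, both from the same side.
  \<open>mul_solve\<close> says, independently of that side, that a nonzero value can be scaled to any other
  and so serves as a pivot. \<open>cancel_lead\<close> is the corresponding statement for leading
  coefficients; for scalars on the right it rests on surjectivity of \<open>\<sigma>\<close>.
\<close>

locale evaluation_family =
  fixes act :: "'a::division_ring \<Rightarrow> 'a poly \<Rightarrow> 'a poly"
    and mul :: "'a \<Rightarrow> 'a \<Rightarrow> 'a"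
    and ev :: "'i \<Rightarrow> 'a poly \<Rightarrow> 'a"
  assumes ev_add: "ev s (f + g) = ev s f + ev s g"
    and ev_act: "ev s (act c f) = mul c (ev s f)"
    and mul_zero: "mul c 0 = 0"
    and mul_solve: "u \<noteq> 0 \<Longrightarrow> \<exists>c. mul c u = w"
    and degree_act_le: "degree (act c f) \<le> degree f"
    and cancel_lead: "f \<noteq> 0 \<Longrightarrow> g \<noteq> 0 \<Longrightarrow> degree f = degree g \<Longrightarrow>
      \<exists>c. f - act c g \<in> polys_below (degree f)"
begin

definition Ker :: "'i set \<Rightarrow> 'a poly set" where
  "Ker S = {f. \<forall>s\<in>S. ev s f = 0}"

text \<open>
  A functional lies in the span of finitely many others iff it vanishes on their common kernel.
  Stating linear independence through kernels avoids a module of functionals, whose scalars would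
  act from the opposite side.
\<close>

definition independent :: "'i set \<Rightarrow> bool" where
  "independent S \<longleftrightarrow> (\<forall>s\<in>S. \<exists>f\<in>Ker (S - {s}). ev s f \<noteq> 0)"

definition interpolates :: "'i set \<Rightarrow> bool" where
  "interpolates S \<longleftrightarrow>
     (\<forall>b. \<exists>!f. f \<in> polys_below (card S) \<and> (\<forall>s\<in>S. ev s f = b s))"

lemma ev_zero [simp]: "ev s 0 = 0"
  using ev_add[of s 0 0] by simp

lemma ev_diff: "ev s (f - g) = ev s f - ev s g"
  using ev_add[of s "f - g" g] by (simp add: algebra_simps)

lemma ev_diff_act: "ev s (f - act c g) = ev s f - mul c (ev s g)"
  by (simp add: ev_diff ev_act)

lemma Ker_diff_act: "f \<in> Ker S \<Longrightarrow> g \<in> Ker S \<Longrightarrow> f - act c g \<in> Ker S"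
  by (simp add: Ker_def ev_diff_act mul_zero)

lemma Ker_empty [simp]: "Ker {} = UNIV"
  by (simp add: Ker_def)

lemma Ker_insert: "f \<in> Ker (insert s S) \<longleftrightarrow> f \<in> Ker S \<and> ev s f = 0"
  by (auto simp: Ker_def)

lemma Ker_antimono: "S \<subseteq> T \<Longrightarrow> Ker T \<subseteq> Ker S"
  by (auto simp: Ker_def)

lemma gaps_UNIV [simp]: "gaps (UNIV :: 'a poly set) = {}"
proof -
  have "n \<notin> gaps (UNIV :: 'a poly set)" for n
    by (rule not_gapI[of "monom 1 n"]) (simp_all add: degree_monom_eq)
  then show ?thesis by blast
qed

text \<open>
  The new gap is the least degree \<open>d\<close> on which the added functional is nonzero. An element of
  degree \<open>d\<close> in the smaller kernel could be used to lower that least degree. An element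
  of any other degree is either killed already, or has degree above \<open>d\<close> and can be corrected by
  a multiple of the degree-\<open>d\<close> witness, without changing its degree.
\<close>

lemma gaps_Ker_insert:
  assumes "h0 \<in> Ker S" "ev s h0 \<noteq> 0"
  obtains d where "d \<notin> gaps (Ker S)" "gaps (Ker (insert s S)) = insert d (gaps (Ker S))"
proof -
  obtain h where h: "h \<in> Ker S" "ev s h \<noteq> 0"
    and least: "\<And>g. g \<in> Ker S \<Longrightarrow> ev s g \<noteq> 0 \<Longrightarrow> degree h \<le> degree g"
    using ex_has_least_nat[of "\<lambda>h. h \<in> Ker S \<and> ev s h \<noteq> 0" h0 degree] assms by blast
  let ?d = "degree h"
  have h0: "h \<noteq> 0" using h(2) by auto
  have "?d \<in> gaps (Ker (insert s S))"
  proof (rule ccontr)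
    assume "?d \<notin> gaps (Ker (insert s S))"
    then obtain g where g: "g \<in> Ker S" "ev s g = 0" "g \<noteq> 0" "degree g = ?d"
      by (auto elim!: not_gapE simp: Ker_insert)
    obtain c where c: "h - act c g \<in> polys_below ?d"
      using cancel_lead[OF h0 g(3)] g(4) by auto
    have "ev s (h - act c g) \<noteq> 0" using h(2) g(2) by (simp add: ev_diff_act mul_zero)
    moreover from this have "degree (h - act c g) < ?d"
      using c in_polys_belowD by fastforce
    ultimately show False
      using least[OF Ker_diff_act[OF h(1) g(1)]] by (simp add: leD)
  qed
  moreover have "n \<notin> gaps (Ker (insert s S))" if n: "n \<notin> gaps (Ker S)" "n \<noteq> ?d" for n
  proof -
    obtain g where g: "g \<in> Ker S" "g \<noteq> 0" "degree g = n" using n(1) by (rule not_gapE)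
    show ?thesis
    proof (cases "ev s g = 0")
      case True
      then show ?thesis using g by (intro not_gapI[of g]) (simp_all add: Ker_insert)
    next
      case False
      obtain c where c: "mul c (ev s h) = ev s g" using mul_solve[OF h(2)] by blast
      have "degree (act c h) < degree g"
        using least[OF g(1) False] n(2) g(3) degree_act_le[of c h] by simp
      then have deg: "degree (g - act c h) = n"
        using degree_add_eq_left[of "- act c h" g] g(3) by simp
      moreover have "g - act c h \<noteq> 0"
        using deg \<open>degree (act c h) < degree g\<close> g(3) by auto
      moreover have "g - act c h \<in> Ker (insert s S)"
        using Ker_diff_act[OF g(1) h(1)] c by (simp add: Ker_insert ev_diff_act)
      ultimately show ?thesis by (intro not_gapI)
    qed
  qed
  moreover have "gaps (Ker S) \<subseteq> gaps (Ker (insert s S))"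
    by (rule gaps_antimono, rule Ker_antimono) blast
  ultimately show thesis
    using not_gapI[OF h(1) h0 refl] by (intro that[of ?d]) blast+
qed

lemma Ker_insert_redundant: "(\<And>f. f \<in> Ker S \<Longrightarrow> ev s f = 0) \<Longrightarrow> Ker (insert s S) = Ker S"
  by (auto simp: Ker_insert)

lemma card_gaps_le:
  assumes "finite S"
  shows "finite (gaps (Ker S)) \<and> card (gaps (Ker S)) \<le> card S"
  using assms
proof (induction S)
  case (insert s S)
  show ?case
  proof (cases "\<exists>h\<in>Ker S. ev s h \<noteq> 0")
    case True
    then obtain h0 where "h0 \<in> Ker S" "ev s h0 \<noteq> 0" by blast
    then obtain d where "d \<notin> gaps (Ker S)" "gaps (Ker (insert s S)) = insert d (gaps (Ker S))"
      by (rule gaps_Ker_insert)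
    then show ?thesis using insert by simp
  next
    case False
    then show ?thesis using insert by (subst (1 2) Ker_insert_redundant) auto
  qed
qed simp

lemma independent_subset:
  assumes "independent T" "S \<subseteq> T"
  shows "independent S"
  unfolding independent_def
proof
  fix s assume "s \<in> S"
  then obtain f where "f \<in> Ker (T - {s})" "ev s f \<noteq> 0"
    using assms by (auto simp: independent_def)
  moreover have "Ker (T - {s}) \<subseteq> Ker (S - {s})" using assms(2) by (intro Ker_antimono) blast
  ultimately show "\<exists>f\<in>Ker (S - {s}). ev s f \<noteq> 0" by blast
qed

lemma card_gaps_independent:
  assumes "finite S" "independent S"
  shows "card (gaps (Ker S)) = card S"
  using assms
proof (induction S)
  case (insert s S)
  have "insert s S - {s} = S" using insert.hyps by blast
  then obtain h0 where "h0 \<in> Ker S" "ev s h0 \<noteq> 0"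
    using insert.prems by (auto simp: independent_def)
  then obtain d where "d \<notin> gaps (Ker S)" "gaps (Ker (insert s S)) = insert d (gaps (Ker S))"
    by (rule gaps_Ker_insert)
  then show ?case
    using insert card_gaps_le[of S] independent_subset[OF insert.prems, of S] by auto
qed simp

text \<open>
  Since the gaps depend on the kernel alone, a redundant functional may be dropped before
  counting, and then the bound is smaller by one.
\<close>

lemma card_gaps_eq_iff_independent:
  assumes "finite S"
  shows "card (gaps (Ker S)) = card S \<longleftrightarrow> independent S"
proof
  assume eq: "card (gaps (Ker S)) = card S"
  show "independent S"
    unfolding independent_def
  proof (rule ballI, rule ccontr)
    fix s assume s: "s \<in> S" and "\<not> (\<exists>f\<in>Ker (S - {s}). ev s f \<noteq> 0)"
    then have "Ker (insert s (S - {s})) = Ker (S - {s})" by (intro Ker_insert_redundant) blast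
    then have "card (gaps (Ker S)) \<le> card (S - {s})"
      using card_gaps_le[of "S - {s}"] assms s by (simp add: insert_absorb)
    then show False using eq card_Diff1_less[OF assms s] by linarith
  qed
qed (use card_gaps_independent assms in blast)

section \<open>Interpolation\<close>

lemma independent_solves:
  assumes "finite S" "independent S"
  shows "\<exists>f. \<forall>s\<in>S. ev s f = b s"
  using assms
proof (induction S)
  case (insert s S)
  obtain f where f: "\<forall>t\<in>S. ev t f = b t"
    using insert independent_subset[OF insert.prems, of S] by blast
  have "insert s S - {s} = S" using insert.hyps by blast
  then obtain h where h: "h \<in> Ker S" "ev s h \<noteq> 0"
    using insert.prems by (auto simp: independent_def)
  obtain c where "mul c (ev s h) = ev s f - b s" using mul_solve[OF h(2)] by blast
  then have "\<forall>t\<in>insert s S. ev t (f - act c h) = b t"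
    using f h(1) by (simp add: ev_diff_act Ker_def mul_zero)
  then show ?case by blast
qed simp

text \<open>
  Division with remainder by a family of kernel elements, one for each large degree, in place of a
  single generator.
\<close>

lemma reduce_degree:
  assumes "gaps (Ker S) \<subseteq> {..<n}"
  obtains g where "g \<in> polys_below n" "\<forall>s\<in>S. ev s g = ev s f"
proof -
  obtain g where g: "\<forall>s\<in>S. ev s g = ev s f"
    and least: "\<And>h. \<forall>s\<in>S. ev s h = ev s f \<Longrightarrow> degree g \<le> degree h"
    using ex_has_least_nat[of "\<lambda>g. \<forall>s\<in>S. ev s g = ev s f" f degree] by blast
  show thesis
  proof (cases "g \<in> polys_below n")
    case False
    then have "g \<noteq> 0" "degree g \<notin> gaps (Ker S)" using assms by (auto simp: polys_below_def)
    from this(2) obtain h where h: "h \<in> Ker S" "h \<noteq> 0" "degree h = degree g"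
      by (rule not_gapE)
    obtain c where c: "g - act c h \<in> polys_below (degree g)"
      using cancel_lead[OF \<open>g \<noteq> 0\<close> h(2)] h(3) by auto
    have vals: "\<forall>s\<in>S. ev s (g - act c h) = ev s f"
      using g h(1) by (simp add: ev_diff_act Ker_def mul_zero)
    \<comment> \<open>The degree cannot drop, so the difference is the zero polynomial.\<close>
    have "g - act c h = 0"
      using least[OF vals] c by (auto simp: polys_below_def)
    then show thesis using vals by (intro that[of 0]) (simp_all add: polys_below_def)
  qed (use g that in blast)
qed

text \<open>
  In general the \<open>card S\<close> gaps may lie anywhere and interpolation below degree \<open>card S\<close> may fail. The
  second hypothesis, which holds for ideals, forces them to be an initial segment.
\<close>

lemma interpolates_iff_independent:
  assumes "finite S" and up: "\<And>n. n \<notin> gaps (Ker S) \<Longrightarrow> Suc n \<notin> gaps (Ker S)"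
  shows "interpolates S \<longleftrightarrow> independent S"
proof
  assume *: "interpolates S"
  show "independent S"
    unfolding independent_def
  proof
    fix s assume "s \<in> S"
    obtain f where "\<forall>t\<in>S. ev t f = (if t = s then 1 else 0)"
      using *[unfolded interpolates_def, rule_format, of "\<lambda>t. if t = s then 1 else 0"] by blast
    then show "\<exists>f\<in>Ker (S - {s}). ev s f \<noteq> 0"
      using \<open>s \<in> S\<close> by (intro bexI[of _ f]) (simp_all add: Ker_def)
  qed
next
  assume ind: "independent S"
  have "gaps (Ker S) = {..<card (gaps (Ker S))}"
    using card_gaps_le[OF assms(1)] up by (intro down_closed_eq_lessThan_card) blast+
  then have G: "gaps (Ker S) = {..<card S}"
    using card_gaps_independent[OF assms(1) ind] by simp
  show "interpolates S"
    unfolding interpolates_def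
  proof (intro allI ex_ex1I)
    fix b
    obtain f where f: "\<forall>s\<in>S. ev s f = b s" using independent_solves[OF assms(1) ind] by blast
    obtain g where "g \<in> polys_below (card S)" "\<forall>s\<in>S. ev s g = ev s f"
      using reduce_degree[of S "card S" f] G by auto
    with f show "\<exists>g. g \<in> polys_below (card S) \<and> (\<forall>s\<in>S. ev s g = b s)" by auto
  next
    fix b f g
    assume f: "f \<in> polys_below (card S) \<and> (\<forall>s\<in>S. ev s f = b s)"
      and g: "g \<in> polys_below (card S) \<and> (\<forall>s\<in>S. ev s g = b s)"
    then have Ker: "f - g \<in> Ker S" by (simp add: Ker_def ev_diff)
    show "f = g"
    proof (rule ccontr)
      assume "f \<noteq> g"
      then have "degree (f - g) < card S"
        using f g degree_diff_less[of f "card S" g] by (auto simp: polys_below_def)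
      then have "degree (f - g) \<in> gaps (Ker S)" using G by simp
      moreover have "f - g \<noteq> 0" using \<open>f \<noteq> g\<close> by simp
      ultimately show False using Ker not_gapI by blast
    qed
  qed
qed

text \<open>
  Finitely many conditions leave finitely many gaps, so the zero polynomial is never a generator.
\<close>

lemma generator_degree_iff:
  assumes "finite S" "f = 0 \<longrightarrow> Ker S = {0}" "f \<noteq> 0 \<longrightarrow> gaps (Ker S) = {..<degree f}"
  shows "f \<noteq> 0 \<and> degree f = card S \<longleftrightarrow> independent S"
proof -
  have "f \<noteq> 0"
  proof
    assume "f = 0"
    then have "gaps (Ker S) = UNIV" using assms(2) by (simp add: gaps_def)
    then show False using card_gaps_le[OF assms(1)] by simp
  qed
  then show ?thesis using card_gaps_eq_iff_independent[OF assms(1)] assms(3) by simp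
qed

lemma module_iso_iff_interpolates:
  assumes "distinct xs"
  shows "module_iso (polys_below (length xs)) (+) act (coord_space (length xs)) (map2 (+))
      (\<lambda>c. map (mul c)) (\<lambda>f. map (\<lambda>s. ev s f) xs) \<longleftrightarrow> interpolates (set xs)"
    (is "module_iso ?U _ _ ?V _ _ ?\<psi> \<longleftrightarrow> _")
proof -
  have linear: "?\<psi> (f + g) = map2 (+) (?\<psi> f) (?\<psi> g)" "?\<psi> (act c f) = map (mul c) (?\<psi> f)" for f g c
    by (simp_all add: ev_add ev_act map2_map_map)
  have bij_iff: "bij_betw ?\<psi> ?U ?V \<longleftrightarrow> (\<forall>v\<in>?V. \<exists>!f. f \<in> ?U \<and> ?\<psi> f = v)"
    by (rule bij_betw_iff_ex1) (simp add: coord_space_def)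
  have lists: "?V = range (\<lambda>b. map b xs)"
  proof
    show "?V \<subseteq> range (\<lambda>b. map b xs)"
    proof
      fix v :: "'a list" assume "v \<in> ?V"
      then have "length xs = length v" by (simp add: coord_space_def)
      then have "v = map (\<lambda>s. the (map_of (zip xs v) s)) xs"
        using assms by (intro nth_equalityI) (simp_all add: map_of_zip_nth)
      then show "v \<in> range (\<lambda>b. map b xs)" by blast
    qed
  qed (auto simp: coord_space_def)
  show ?thesis
    unfolding module_iso_def bij_iff unfolding lists interpolates_def
    using linear by (simp add: distinct_card[OF assms])
qed

end

section \<open>From strict chains of ideals to independence\<close>

text \<open>
  The index \<open>(j, i)\<close> stands for the evaluation of order \<open>i\<close> at the \<open>j\<close>-th point.
\<close>

locale jet_family = evaluation_family act mul ev
  for act :: "'a::division_ring \<Rightarrow> 'a poly \<Rightarrow> 'a poly"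
    and mul :: "'a \<Rightarrow> 'a \<Rightarrow> 'a"
    and ev :: "'j \<times> nat \<Rightarrow> 'a poly \<Rightarrow> 'a"
begin

text \<open>
  The chain at \<open>j\<close> supplies, for each order \<open>s\<close>, a polynomial that vanishes to all orders below
  \<open>s\<close> at the \<open>j\<close>-th point and to the prescribed orders at the other points. These form a
  triangular system, solved by induction on the number of orders already cleared.
\<close>

lemma independent_Sigma_iff:
  fixes m :: "'j \<Rightarrow> nat"
  shows "independent (Sigma J (\<lambda>j. {..m j})) \<longleftrightarrow>
    (\<forall>j\<in>J. \<forall>s\<le>m j. \<exists>f\<in>Ker (Sigma (J - {j}) (\<lambda>j. {..m j})).
       (\<forall>i<s. ev (j, i) f = 0) \<and> ev (j, s) f \<noteq> 0)"
    (is "_ \<longleftrightarrow> ?chains")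
proof
  assume ind: "independent (Sigma J (\<lambda>j. {..m j}))"
  show ?chains
  proof (intro ballI allI impI)
    fix j s assume js: "j \<in> J" "s \<le> m j"
    then obtain f where f: "f \<in> Ker (Sigma J (\<lambda>j. {..m j}) - {(j, s)})" "ev (j, s) f \<noteq> 0"
      using ind unfolding independent_def by force
    moreover from f(1) js have "f \<in> Ker (Sigma (J - {j}) (\<lambda>j. {..m j}))" "\<forall>i<s. ev (j, i) f = 0"
      by (auto simp: Ker_def)
    ultimately show "\<exists>f\<in>Ker (Sigma (J - {j}) (\<lambda>j. {..m j})).
       (\<forall>i<s. ev (j, i) f = 0) \<and> ev (j, s) f \<noteq> 0" by blast
  qed
next
  assume chains: ?chains
  show "independent (Sigma J (\<lambda>j. {..m j}))"
    unfolding independent_def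
  proof
    fix p assume "p \<in> Sigma J (\<lambda>j. {..m j})"
    then obtain j s where p: "p = (j, s)" "j \<in> J" "s \<le> m j" by auto
    let ?K = "Ker (Sigma (J - {j}) (\<lambda>j. {..m j}))"
    have "n \<le> m j \<longrightarrow> (\<exists>g\<in>?K. (\<forall>i\<le>n. i \<noteq> s \<longrightarrow> ev (j, i) g = 0) \<and> ev (j, s) g \<noteq> 0)"
      if "s \<le> n" for n
      using that
    proof (induction n rule: dec_induct)
      case base
      have "\<exists>g\<in>?K. (\<forall>i<s. ev (j, i) g = 0) \<and> ev (j, s) g \<noteq> 0"
        using chains p(2,3) by blast
      then show ?case by (metis le_neq_implies_less)
    next
      case (step n)
      show ?case
      proof
        assume n: "Suc n \<le> m j"
        then obtain g where g: "g \<in> ?K" "\<forall>i\<le>n. i \<noteq> s \<longrightarrow> ev (j, i) g = 0" "ev (j, s) g \<noteq> 0"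
          using step.IH by auto
        obtain h where h: "h \<in> ?K" "\<forall>i<Suc n. ev (j, i) h = 0" "ev (j, Suc n) h \<noteq> 0"
          using chains p(2) n by blast
        obtain c where c: "mul c (ev (j, Suc n) h) = ev (j, Suc n) g"
          using mul_solve[OF h(3)] by blast
        have "g - act c h \<in> ?K" using g(1) h(1) by (rule Ker_diff_act)
        moreover have "\<forall>i\<le>Suc n. i \<noteq> s \<longrightarrow> ev (j, i) (g - act c h) = 0"
          using g(2) h(2) c by (auto simp: ev_diff_act mul_zero le_Suc_eq)
        moreover have "ev (j, s) (g - act c h) \<noteq> 0"
          using g(3) h(2) step.hyps by (simp add: ev_diff_act mul_zero)
        ultimately show "\<exists>g\<in>?K. (\<forall>i\<le>Suc n. i \<noteq> s \<longrightarrow> ev (j, i) g = 0) \<and> ev (j, s) g \<noteq> 0"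
          by blast
      qed
    qed
    from this[OF p(3)] obtain g where "g \<in> ?K" "\<forall>i\<le>m j. i \<noteq> s \<longrightarrow> ev (j, i) g = 0" "ev (j, s) g \<noteq> 0"
      by blast
    moreover from this(1,2) have "g \<in> Ker (Sigma J (\<lambda>j. {..m j}) - {p})"
      by (auto simp: Ker_def p(1))
    ultimately show "\<exists>f\<in>Ker (Sigma J (\<lambda>j. {..m j}) - {p}). ev p f \<noteq> 0"
      using p(1) by blast
  qed
qed

end

text \<open>
  Each inclusion in the chain is strict iff the one condition added at that step is violated by some element of
  the preceding set.
\<close>

lemma strict_chain_iff:
  fixes e :: "'b \<Rightarrow> nat \<Rightarrow> 'v \<Rightarrow> 'a::zero"
  assumes I_def: "\<And>P. I P = {f. \<forall>(b, n)\<in>P. \<forall>i\<le>n. e b i f = 0}"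
  shows "I (insert (b, 0) P) \<subset> I P \<and> (\<forall>s<t. I (insert (b, Suc s) P) \<subset> I (insert (b, s) P)) \<longleftrightarrow>
    (\<forall>s\<le>t. \<exists>f\<in>I P. (\<forall>i<s. e b i f = 0) \<and> e b s f \<noteq> 0)"
proof -
  have ins: "f \<in> I (insert (b, n) P) \<longleftrightarrow> f \<in> I P \<and> (\<forall>i\<le>n. e b i f = 0)" for f n
    by (auto simp: I_def)
  have "I (insert (b, 0) P) \<subset> I P \<longleftrightarrow> (\<exists>f\<in>I P. e b 0 f \<noteq> 0)"
    unfolding psubset_eq subset_iff set_eq_iff ins by auto
  moreover have "I (insert (b, Suc s) P) \<subset> I (insert (b, s) P) \<longleftrightarrow>
      (\<exists>f\<in>I P. (\<forall>i\<le>s. e b i f = 0) \<and> e b (Suc s) f \<noteq> 0)" for s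
    unfolding psubset_eq subset_iff set_eq_iff ins by (auto simp: le_Suc_eq)
  moreover have "(\<forall>s\<le>t. Q s) \<longleftrightarrow> Q 0 \<and> (\<forall>s<t. Q (Suc s))" for Q
    by (metis Suc_leI bot_nat_0.extremum less_Suc_eq_le not0_implies_Suc Suc_le_lessD)
  ultimately show ?thesis by (simp add: less_Suc_eq_le)
qed

text \<open>The order in which \<open>\<psi>\<close> lists the coordinates.\<close>

definition jet_index :: "nat \<Rightarrow> (nat \<Rightarrow> nat) \<Rightarrow> (nat \<times> nat) list" where
  "jet_index k m = concat (map (\<lambda>j. map (Pair j) [0..<m j + 1]) [1..<k + 1])"

lemma set_jet_index: "set (jet_index k m) = Sigma {1..k} (\<lambda>j. {..m j})"
  by (auto simp: jet_index_def image_iff simp del: upt_Suc)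

lemma length_jet_index: "length (jet_index k m) = (\<Sum>j = 1..k. m j + 1)"
  by (simp add: jet_index_def length_concat comp_def interv_sum_list_conv_sum_set_nat
      atLeastLessThanSuc_atLeastAtMost del: upt_Suc)

lemma card_Sigma_jets: "card (Sigma {1..k} (\<lambda>j. {..m j})) = (\<Sum>j = 1..k. m j + 1)"
  for k :: nat
  by (subst card_SigmaI) simp_all

lemma distinct_jet_index: "distinct (jet_index k m)"
  by (rule card_distinct) (simp only: set_jet_index length_jet_index card_Sigma_jets)

lemma Ball_Sigma_jets:
  "(\<forall>s\<in>Sigma J (\<lambda>j. {..m j}). Q s) \<longleftrightarrow> (\<forall>j\<in>J. \<forall>i\<le>m j. Q (j, i))"
  by auto

lemma all_curry: "(\<forall>b. Q b) \<longleftrightarrow> (\<forall>b. Q (case_prod b))"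
  by (metis case_prod_curry)


section \<open>Right and left evaluations as evaluation families\<close>

context skew_derivation
begin

text \<open>
  Constants multiply from the side opposite to the factor \<open>x - a\<close>, so they pass through the division with
  remainder; this is why right evaluations are left linear and left evaluations right linear.
\<close>

lemma right_scale:
  "right_diff \<sigma> \<delta> a ([:c:] \<circledast> f) = [:c:] \<circledast> right_diff \<sigma> \<delta> a f"
  "right_eval \<sigma> \<delta> a ([:c:] \<circledast> f) = c * right_eval \<sigma> \<delta> a f"
proof -
  have "[:c:] \<circledast> f = ([:c:] \<circledast> right_diff \<sigma> \<delta> a f) \<circledast> [:- a, 1:] + [:c * right_eval \<sigma> \<delta> a f:]"
    by (subst right_decomp[of f a])
      (simp add: skew_mult_add_right skew_mult_assoc const_skew_mult[of c "[:_:]"] map_poly_pCons)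
  from right_eqI[OF this] show
    "right_diff \<sigma> \<delta> a ([:c:] \<circledast> f) = [:c:] \<circledast> right_diff \<sigma> \<delta> a f"
    "right_eval \<sigma> \<delta> a ([:c:] \<circledast> f) = c * right_eval \<sigma> \<delta> a f" .
qed

lemma right_pow_scale:
  "(right_diff \<sigma> \<delta> a ^^ i) ([:c:] \<circledast> f) = [:c:] \<circledast> (right_diff \<sigma> \<delta> a ^^ i) f"
  by (induction i) (simp_all add: right_scale)

lemma left_scale:
  assumes "bij \<sigma>"
  shows "left_diff \<sigma> \<delta> a (f \<circledast> [:c:]) = left_diff \<sigma> \<delta> a f \<circledast> [:c:]"
    "left_eval \<sigma> \<delta> a (f \<circledast> [:c:]) = left_eval \<sigma> \<delta> a f * c"
proof -
  have "f \<circledast> [:c:] = [:- a, 1:] \<circledast> (left_diff \<sigma> \<delta> a f \<circledast> [:c:]) + [:left_eval \<sigma> \<delta> a f * c:]"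
    by (subst left_decomp[OF assms, of f a])
      (simp add: skew_mult_add_left skew_mult_assoc const_skew_mult[of _ "[:c:]"] map_poly_pCons)
  from left_eqI[OF this] show
    "left_diff \<sigma> \<delta> a (f \<circledast> [:c:]) = left_diff \<sigma> \<delta> a f \<circledast> [:c:]"
    "left_eval \<sigma> \<delta> a (f \<circledast> [:c:]) = left_eval \<sigma> \<delta> a f * c" .
qed

lemma left_pow_scale:
  assumes "bij \<sigma>"
  shows "(left_diff \<sigma> \<delta> a ^^ i) (f \<circledast> [:c:]) = (left_diff \<sigma> \<delta> a ^^ i) f \<circledast> [:c:]"
  by (induction i) (simp_all add: left_scale assms)

definition jet_R :: "(nat \<Rightarrow> 'a) \<Rightarrow> nat \<times> nat \<Rightarrow> 'a poly \<Rightarrow> 'a" where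
  "jet_R a = (\<lambda>(j, i) f. right_eval \<sigma> \<delta> (a j) ((right_diff \<sigma> \<delta> (a j) ^^ i) f))"

definition jet_L :: "(nat \<Rightarrow> 'a) \<Rightarrow> nat \<times> nat \<Rightarrow> 'a poly \<Rightarrow> 'a" where
  "jet_L a = (\<lambda>(j, i) f. left_eval \<sigma> \<delta> (a j) ((left_diff \<sigma> \<delta> (a j) ^^ i) f))"

lemma degree_skew_mult_const:
  assumes "c \<noteq> 0"
  shows "degree ([:c:] \<circledast> f) = degree f" "degree (f \<circledast> [:c:]) = degree f"
  by (cases "f = 0"; simp add: assms skew_mult_nonzero)+

lemma jet_family_R: "jet_family (\<lambda>c f. [:c:] \<circledast> f) (\<lambda>c y. c * y) (jet_R a)"
proof
  fix f g :: "'a poly" assume fg: "f \<noteq> 0" "g \<noteq> 0" "degree f = degree g"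
  define c where "c = lead_coeff f * inverse (lead_coeff g)"
  have "lead_coeff f \<noteq> 0" "lead_coeff g \<noteq> 0" using fg(1,2) by simp_all
  then have c: "c \<noteq> 0" "c * lead_coeff g = lead_coeff f"
    by (simp_all add: c_def mult.assoc)
  have coeff_prod: "coeff ([:c:] \<circledast> g) n = c * coeff g n" for n
    by (simp add: const_skew_mult)
  have "f - [:c:] \<circledast> g = 0 \<or> degree (f - [:c:] \<circledast> g) < degree f"
    using fg(3) c coeff_prod by (intro division_step) (simp_all add: degree_skew_mult_const)
  then show "\<exists>c. f - [:c:] \<circledast> g \<in> polys_below (degree f)" by (auto simp: polys_below_def)
next
  fix u w :: 'a assume "u \<noteq> 0"
  then have "w * inverse u * u = w" by (simp add: mult.assoc)
  then show "\<exists>c. c * u = w" by blast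
next
  fix c and f :: "'a poly"
  show "degree ([:c:] \<circledast> f) \<le> degree f" using degree_skew_mult_le[of "[:c:]" f] by simp
qed (auto simp: jet_R_def right_pow_add right_diff_add right_pow_scale right_scale)

lemma jet_family_L:
  assumes "bij \<sigma>"
  shows "jet_family (\<lambda>c f. f \<circledast> [:c:]) (\<lambda>c y. y * c) (jet_L a)"
proof
  fix f g :: "'a poly" assume fg: "f \<noteq> 0" "g \<noteq> 0" "degree f = degree g"
  have "surj (\<sigma> ^^ degree g)" using assms by (simp add: bij_is_surj surj_fn)
  then obtain c where c: "inverse (lead_coeff g) * lead_coeff f = (\<sigma> ^^ degree g) c"
    by (metis surjD)
  have "lead_coeff f \<noteq> 0" "lead_coeff g \<noteq> 0" using fg(1,2) by simp_all
  then have "(\<sigma> ^^ degree g) c \<noteq> 0" by (simp flip: c)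
  then have "c \<noteq> 0" by simp
  have "lead_coeff (g \<circledast> [:c:]) = lead_coeff g * (\<sigma> ^^ degree g) c"
    using lead_skew_mult[of g "[:c:]"] \<open>c \<noteq> 0\<close> by (simp add: degree_skew_mult_const)
  also have "\<dots> = lead_coeff f" using fg by (simp flip: c mult.assoc)
  finally have "f - g \<circledast> [:c:] = 0 \<or> degree (f - g \<circledast> [:c:]) < degree f"
    using fg(3) \<open>c \<noteq> 0\<close> by (intro division_step) (simp_all add: degree_skew_mult_const)
  then show "\<exists>c. f - g \<circledast> [:c:] \<in> polys_below (degree f)" by (auto simp: polys_below_def)
next
  fix u w :: 'a assume "u \<noteq> 0"
  then have "u * (inverse u * w) = w" by (simp flip: mult.assoc)
  then show "\<exists>c. u * c = w" by blast
next
  fix c and f :: "'a poly"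
  show "degree (f \<circledast> [:c:]) \<le> degree f" using degree_skew_mult_le[of f "[:c:]"] by simp
qed (auto simp: jet_L_def left_pow_add left_diff_add left_pow_scale left_scale assms)

text \<open>
  Degrees add under skew multiplication, so a principal ideal attains exactly the degrees from that of its
  generator on.
\<close>

lemma gaps_left_ideal:
  assumes "f \<noteq> 0"
  shows "gaps (range (\<lambda>g. g \<circledast> f)) = {..<degree f}"
proof (intro set_eqI iffI)
  fix n assume *: "n \<in> gaps (range (\<lambda>g. g \<circledast> f))"
  show "n \<in> {..<degree f}"
  proof (rule ccontr)
    assume "n \<notin> {..<degree f}"
    then have "degree (monom 1 (n - degree f) \<circledast> f) = n" "monom 1 (n - degree f) \<circledast> f \<noteq> 0"
      using assms by (simp_all add: skew_mult_nonzero degree_monom_eq)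
    then show False using * by (auto simp: gaps_def)
  qed
next
  fix n assume n: "n \<in> {..<degree f}"
  have "degree (g \<circledast> f) \<noteq> n" if "g \<circledast> f \<noteq> 0" for g
    using that n assms by (cases "g = 0") (simp_all add: skew_mult_nonzero)
  then show "n \<in> gaps (range (\<lambda>g. g \<circledast> f))" by (auto simp: gaps_def)
qed

lemma gaps_right_ideal:
  assumes "f \<noteq> 0"
  shows "gaps (range (\<lambda>g. f \<circledast> g)) = {..<degree f}"
proof (intro set_eqI iffI)
  fix n assume *: "n \<in> gaps (range (\<lambda>g. f \<circledast> g))"
  show "n \<in> {..<degree f}"
  proof (rule ccontr)
    assume "n \<notin> {..<degree f}"
    then have "degree (f \<circledast> monom 1 (n - degree f)) = n" "f \<circledast> monom 1 (n - degree f) \<noteq> 0"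
      using assms by (simp_all add: skew_mult_nonzero degree_monom_eq)
    then show False using * by (auto simp: gaps_def)
  qed
next
  fix n assume n: "n \<in> {..<degree f}"
  have "degree (f \<circledast> g) \<noteq> n" if "f \<circledast> g \<noteq> 0" for g
    using that n assms by (cases "g = 0") (simp_all add: skew_mult_nonzero)
  then show "n \<in> gaps (range (\<lambda>g. f \<circledast> g))" by (auto simp: gaps_def)
qed

end

section \<open>The equivalent forms of independence\<close>

context skew_derivation
begin

text \<open>
  All conditions are compared with unique interpolation; interpolation and the degree condition both reduce
  to independence, to which the kernel counting and the elimination apply.
\<close>

lemma left_equivalences:
  fixes a :: "nat \<Rightarrow> 'a"
  assumes inj: "inj_on a {1..k}" and N: "N = (\<Sum>j = 1..k. m j + 1)"
  defines "interp \<equiv> \<forall>b :: nat \<Rightarrow> nat \<Rightarrow> 'a. \<exists>!f. f \<in> polys_below N \<and>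
          (\<forall>j\<in>{1..k}. \<forall>i\<le>m j.
             right_eval \<sigma> \<delta> (a j) ((right_diff \<sigma> \<delta> (a j) ^^ i) f) = b j i)"
  shows "left_F_iso \<sigma> \<delta> N (psi_R \<sigma> \<delta> k a m) \<longleftrightarrow> interp"
    and "left_DP_indep \<sigma> \<delta> k a m \<longleftrightarrow> interp"
    and "generates_left_ideal \<sigma> \<delta> f (ideal_R \<sigma> \<delta> (weighted_points a m {1..k})) \<Longrightarrow>
      f \<noteq> 0 \<and> degree f = N \<longleftrightarrow> interp"
proof -
  interpret jet_family "\<lambda>c f. [:c:] \<circledast> f" "\<lambda>c y. c * y" "jet_R a" by (rule jet_family_R)
  let ?S = "Sigma {1..k} (\<lambda>j. {..m j})"
  have card: "card ?S = N" by (simp only: card_Sigma_jets N)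
  have Ker: "ideal_R \<sigma> \<delta> (weighted_points a m J) = Ker (Sigma J (\<lambda>j. {..m j}))" for J
    unfolding Ker_def by (auto simp: ideal_R_def weighted_points_def jet_R_def)
  have interp: "interp \<longleftrightarrow> interpolates ?S"
    unfolding interp_def interpolates_def card Ball_Sigma_jets
    by (subst all_curry[of "\<lambda>b. \<exists>!f. f \<in> polys_below N \<and>
        (\<forall>j\<in>{1..k}. \<forall>i\<le>m j. jet_R a (j, i) f = b (j, i))"]) (simp add: jet_R_def)
  \<comment> \<open>The kernel is an ideal, so multiplying by \<open>x\<close> raises degrees by one inside it.\<close>
  have up: "Suc n \<notin> gaps (Ker ?S)" if "n \<notin> gaps (Ker ?S)" for n
  proof -
    from that obtain g where g: "g \<in> Ker ?S" "g \<noteq> 0" "degree g = n" by (rule not_gapE)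
    then show ?thesis
      by (intro not_gapI[of "[:0, 1:] \<circledast> g"]) (simp_all add: skew_mult_nonzero ideal_R_mult flip: Ker)
  qed
  have indep: "interp \<longleftrightarrow> independent ?S"
    unfolding interp by (rule interpolates_iff_independent[OF _ up]) simp
  have "psi_R \<sigma> \<delta> k a m = (\<lambda>f. map (\<lambda>s. jet_R a s f) (jet_index k m))"
    by (simp add: fun_eq_iff psi_R_def jet_index_def map_concat jet_R_def comp_def)
  then show "left_F_iso \<sigma> \<delta> N (psi_R \<sigma> \<delta> k a m) \<longleftrightarrow> interp"
    using module_iso_iff_interpolates[OF distinct_jet_index, of k m]
    by (simp only: left_F_iso_def interp length_jet_index set_jet_index N)
  have "left_DP_indep_from \<sigma> \<delta> (weighted_points a m ({1..k} - {j})) (m j) (a j) \<longleftrightarrow>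
      (\<forall>s\<le>m j. \<exists>f\<in>Ker (Sigma ({1..k} - {j}) (\<lambda>j. {..m j})).
         (\<forall>i<s. jet_R a (j, i) f = 0) \<and> jet_R a (j, s) f \<noteq> 0)" if "j \<in> {1..k}" for j
  proof -
    have "a j \<notin> fst ` weighted_points a m ({1..k} - {j})"
      unfolding weighted_points_def image_image fst_conv
      using inj_on_image_mem_iff[OF inj that, of "{1..k} - {j}"] by simp
    then show ?thesis
      unfolding left_DP_indep_from_def strict_chain_iff[of "ideal_R \<sigma> \<delta>", OF ideal_R_def]
        Ker[symmetric]
      by (simp add: jet_R_def)
  qed
  then show "left_DP_indep \<sigma> \<delta> k a m \<longleftrightarrow> interp"
    unfolding indep independent_Sigma_iff left_DP_indep_def by blast
  assume "generates_left_ideal \<sigma> \<delta> f (ideal_R \<sigma> \<delta> (weighted_points a m {1..k}))"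
  then have K: "Ker ?S = range (\<lambda>g. g \<circledast> f)"
    unfolding generates_left_ideal_def Ker .
  show "f \<noteq> 0 \<and> degree f = N \<longleftrightarrow> interp"
    unfolding indep card[symmetric]
    by (rule generator_degree_iff, simp; unfold K) (auto simp: gaps_left_ideal)
qed

lemma right_equivalences:
  fixes a :: "nat \<Rightarrow> 'a"
  assumes bij: "bij \<sigma>" and inj: "inj_on a {1..k}" and N: "N = (\<Sum>j = 1..k. m j + 1)"
  defines "interp \<equiv> \<forall>b :: nat \<Rightarrow> nat \<Rightarrow> 'a. \<exists>!f. f \<in> polys_below N \<and>
          (\<forall>j\<in>{1..k}. \<forall>i\<le>m j.
             left_eval \<sigma> \<delta> (a j) ((left_diff \<sigma> \<delta> (a j) ^^ i) f) = b j i)"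
  shows "right_F_iso \<sigma> \<delta> N (psi_L \<sigma> \<delta> k a m) \<longleftrightarrow> interp"
    and "right_DP_indep \<sigma> \<delta> k a m \<longleftrightarrow> interp"
    and "generates_right_ideal \<sigma> \<delta> f (ideal_L \<sigma> \<delta> (weighted_points a m {1..k})) \<Longrightarrow>
      f \<noteq> 0 \<and> degree f = N \<longleftrightarrow> interp"
proof -
  interpret jet_family "\<lambda>c f. f \<circledast> [:c:]" "\<lambda>c y. y * c" "jet_L a" using bij by (rule jet_family_L)
  let ?S = "Sigma {1..k} (\<lambda>j. {..m j})"
  have card: "card ?S = N" by (simp only: card_Sigma_jets N)
  have Ker: "ideal_L \<sigma> \<delta> (weighted_points a m J) = Ker (Sigma J (\<lambda>j. {..m j}))" for J
    unfolding Ker_def by (auto simp: ideal_L_def weighted_points_def jet_L_def)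
  have interp: "interp \<longleftrightarrow> interpolates ?S"
    unfolding interp_def interpolates_def card Ball_Sigma_jets
    by (subst all_curry[of "\<lambda>b. \<exists>!f. f \<in> polys_below N \<and>
        (\<forall>j\<in>{1..k}. \<forall>i\<le>m j. jet_L a (j, i) f = b (j, i))"]) (simp add: jet_L_def)
  \<comment> \<open>The kernel is an ideal, so multiplying by \<open>x\<close> raises degrees by one inside it.\<close>
  have up: "Suc n \<notin> gaps (Ker ?S)" if "n \<notin> gaps (Ker ?S)" for n
  proof -
    from that obtain g where g: "g \<in> Ker ?S" "g \<noteq> 0" "degree g = n" by (rule not_gapE)
    then show ?thesis
      by (intro not_gapI[of "g \<circledast> [:0, 1:]"]) (simp_all add: skew_mult_nonzero ideal_L_mult bij flip: Ker)
  qed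
  have indep: "interp \<longleftrightarrow> independent ?S"
    unfolding interp by (rule interpolates_iff_independent[OF _ up]) simp
  have "psi_L \<sigma> \<delta> k a m = (\<lambda>f. map (\<lambda>s. jet_L a s f) (jet_index k m))"
    by (simp add: fun_eq_iff psi_L_def jet_index_def map_concat jet_L_def comp_def)
  then show "right_F_iso \<sigma> \<delta> N (psi_L \<sigma> \<delta> k a m) \<longleftrightarrow> interp"
    using module_iso_iff_interpolates[OF distinct_jet_index, of k m]
    by (simp only: right_F_iso_def interp length_jet_index set_jet_index N)
  have "right_DP_indep_from \<sigma> \<delta> (weighted_points a m ({1..k} - {j})) (m j) (a j) \<longleftrightarrow>
      (\<forall>s\<le>m j. \<exists>f\<in>Ker (Sigma ({1..k} - {j}) (\<lambda>j. {..m j})).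
         (\<forall>i<s. jet_L a (j, i) f = 0) \<and> jet_L a (j, s) f \<noteq> 0)" if "j \<in> {1..k}" for j
  proof -
    have "a j \<notin> fst ` weighted_points a m ({1..k} - {j})"
      unfolding weighted_points_def image_image fst_conv
      using inj_on_image_mem_iff[OF inj that, of "{1..k} - {j}"] by simp
    then show ?thesis
      unfolding right_DP_indep_from_def strict_chain_iff[of "ideal_L \<sigma> \<delta>", OF ideal_L_def]
        Ker[symmetric]
      by (simp add: jet_L_def)
  qed
  then show "right_DP_indep \<sigma> \<delta> k a m \<longleftrightarrow> interp"
    unfolding indep independent_Sigma_iff right_DP_indep_def by blast
  assume "generates_right_ideal \<sigma> \<delta> f (ideal_L \<sigma> \<delta> (weighted_points a m {1..k}))"
  then have K: "Ker ?S = range (\<lambda>g. f \<circledast> g)"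
    unfolding generates_right_ideal_def Ker .
  show "f \<noteq> 0 \<and> degree f = N \<longleftrightarrow> interp"
    unfolding indep card[symmetric]
    by (rule generator_degree_iff, simp; unfold K) (auto simp: gaps_right_ideal)
qed

end

theorem theorem3p20:
  fixes \<sigma> \<delta> :: "'a::division_ring \<Rightarrow> 'a"
    and k N :: nat and a :: "nat \<Rightarrow> 'a" and m :: "nat \<Rightarrow> nat"
  assumes "skew_derivation \<sigma> \<delta>"
    and "k \<ge> 1" and "inj_on a {1..k}"
    and "N = (\<Sum>j = 1..k. m j + 1)"
  shows
    "((\<forall>f. generates_left_ideal \<sigma> \<delta> f (ideal_R \<sigma> \<delta> (weighted_points a m {1..k})) \<longrightarrow>
          ((f \<noteq> 0 \<and> degree f = N) \<longleftrightarrow> left_F_iso \<sigma> \<delta> N (psi_R \<sigma> \<delta> k a m)) \<and>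
          (left_DP_indep \<sigma> \<delta> k a m \<longleftrightarrow> (f \<noteq> 0 \<and> degree f = N))) \<and>
      (left_F_iso \<sigma> \<delta> N (psi_R \<sigma> \<delta> k a m) \<longleftrightarrow>
        (\<forall>b :: nat \<Rightarrow> nat \<Rightarrow> 'a. \<exists>!f. f \<in> polys_below N \<and>
          (\<forall>j\<in>{1..k}. \<forall>i\<le>m j.
             right_eval \<sigma> \<delta> (a j) ((right_diff \<sigma> \<delta> (a j) ^^ i) f) = b j i))) \<and>
      ((\<forall>b :: nat \<Rightarrow> nat \<Rightarrow> 'a. \<exists>!f. f \<in> polys_below N \<and>
          (\<forall>j\<in>{1..k}. \<forall>i\<le>m j.
             right_eval \<sigma> \<delta> (a j) ((right_diff \<sigma> \<delta> (a j) ^^ i) f) = b j i)) \<longleftrightarrow>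
        left_DP_indep \<sigma> \<delta> k a m))
     \<and>
     (bij \<sigma> \<longrightarrow>
      (\<forall>f. generates_right_ideal \<sigma> \<delta> f (ideal_L \<sigma> \<delta> (weighted_points a m {1..k})) \<longrightarrow>
          ((f \<noteq> 0 \<and> degree f = N) \<longleftrightarrow> right_F_iso \<sigma> \<delta> N (psi_L \<sigma> \<delta> k a m)) \<and>
          (right_DP_indep \<sigma> \<delta> k a m \<longleftrightarrow> (f \<noteq> 0 \<and> degree f = N))) \<and>
      (right_F_iso \<sigma> \<delta> N (psi_L \<sigma> \<delta> k a m) \<longleftrightarrow>
        (\<forall>b :: nat \<Rightarrow> nat \<Rightarrow> 'a. \<exists>!f. f \<in> polys_below N \<and>
          (\<forall>j\<in>{1..k}. \<forall>i\<le>m j.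
             left_eval \<sigma> \<delta> (a j) ((left_diff \<sigma> \<delta> (a j) ^^ i) f) = b j i))) \<and>
      ((\<forall>b :: nat \<Rightarrow> nat \<Rightarrow> 'a. \<exists>!f. f \<in> polys_below N \<and>
          (\<forall>j\<in>{1..k}. \<forall>i\<le>m j.
             left_eval \<sigma> \<delta> (a j) ((left_diff \<sigma> \<delta> (a j) ^^ i) f) = b j i)) \<longleftrightarrow>
        right_DP_indep \<sigma> \<delta> k a m))"
proof -
  interpret skew_derivation \<sigma> \<delta> by fact
  note l = left_equivalences[OF assms(3,4)] and r = right_equivalences[OF _ assms(3,4)]
  show ?thesis
    by (intro conjI allI impI; simp only: l r)
qed

end
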